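(* Let $r\geq 1$ be a fixed integer. As $n\to\infty$, the normalised random variable $n^{-2/3}S_{n,r}$ converges in distribution to the normal distribution $\mathcal N(\mu,\sigma^2)$ with $$\mu=\frac{r^{1/3}\pi^2}{2^{5/3}(\zeta(3))^{2/3}}\quad\text{and}\quad \sigma^2=\frac{r^{5/3}}{(2\zeta(3))^{1/3}},$$ where $\zeta(s)$ is Riemann's zeta function.
   Context: For integers $r\ge1$, $n\ge 0$, let $M_{n,r}(T)$ be the coefficient of $q^n$ in $$\mathsf{DT}_r^{\mathrm{points}}(\mathbb A^3,q)=\prod_{m\geq 1}\prod_{k=0}^{rm-1}\left(1-T^{4+2k-rm}q^{m}\right)^{-1},$$ the generating function of rank $r$ motivic Donaldson–Thomas invariants of $\mathbb A^3$ written in the variable $T=\mathbb L^{1/2}$. It is a Laurent polynomial in $T$ with nonnegative integer coefficients, and $M_{n,r}(1)$ is the number of $r$-tuples of plane partitions $\overline\pi=(\pi_1,\dots,\pi_r)$ of total size $\sum_l|\pi_l|=n$. One can write $M_{n,r}(T)=\sum_{\overline\pi}T^{S_{n,r}(\overline\pi)}$, the sum being over all $r$-tuples of plane partitions of total size $n$, and $S_{n,r}$ is viewed as a random variable on this set of $r$-tuples equipped with the uniform distribution. Thus $S_{n,r}$ is the integer-valued random variable whose distribution is determined by $$\mathbb E\left(T^{S_{n,r}}\right)=\frac{M_{n,r}(T)}{M_{n,r}(1)},$$ i.e. $\mathbb P(S_{n,r}=s)$ is the coefficient of $T^s$ in $M_{n,r}(T)$ divided by $M_{n,r}(1)$. 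*)

theory Defs
  imports
    "HOL-Probability.Probability"
    "HOL-Computational_Algebra.Formal_Laurent_Series"
begin

text \<open>
  The outer variable \<open>q\<close> is \<^term>\<open>fps_X\<close> and the inner variable \<open>T\<close> (the square root of
  the Lefschetz motive) is \<^term>\<open>fls_X\<close>. The infinite product is taken in the topology of formal
  power series in \<open>q\<close>, i.e. every coefficient of \<open>q ^ n\<close> must be eventually constant; it is
  shown to converge in \<open>has_prod_DT_points\<close> below. The library product is indexed from \<open>0\<close>,
  hence \<^term>\<open>Suc m\<close>.
\<close>

definition DT_factor :: "nat \<Rightarrow> nat \<Rightarrow> real fls fps" where
  "DT_factor r m =
     (\<Prod>k<r * m. inverse (1 - fps_const (fls_X powi (4 + 2 * int k - int (r * m))) * fps_X ^ m))"

definition DT_points :: "nat \<Rightarrow> real fls fps" where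
  "DT_points r = (\<Prod>m. DT_factor r (Suc m))"

definition DT_coeff :: "nat \<Rightarrow> nat \<Rightarrow> real fls" where
  "DT_coeff n r = fps_nth (DT_points r) n"

text \<open>Evaluation of a Laurent polynomial, i.e. of a Laurent series with finite support.\<close>

definition laurent_poly_eval :: "real fls \<Rightarrow> real \<Rightarrow> real" where
  "laurent_poly_eval f x = (\<Sum>s | fls_nth f s \<noteq> 0. fls_nth f s * x powi s)"

text \<open>The Dirichlet series of Riemann's zeta function; meaningful for \<open>s > 1\<close>.\<close>

definition zeta :: "real \<Rightarrow> real" where
  "zeta s = (\<Sum>n. 1 / real (Suc n) powr s)"


subsection \<open>The definitions are meaningful\<close>

definition nonneg_laurent_poly :: "real fls \<Rightarrow> bool" where
  "nonneg_laurent_poly f \<longleftrightarrow> (\<forall>s. fls_nth f s \<ge> 0) \<and> finite {s. fls_nth f s \<noteq> 0}"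

lemma nonneg_laurent_poly_0: "nonneg_laurent_poly 0"
  by (simp add: nonneg_laurent_poly_def)

lemma nonneg_laurent_poly_1: "nonneg_laurent_poly 1"
  by (simp add: nonneg_laurent_poly_def)

lemma nonneg_laurent_poly_add:
  assumes "nonneg_laurent_poly f" "nonneg_laurent_poly g"
  shows "nonneg_laurent_poly (f + g)"
proof -
  have "{s. fls_nth (f + g) s \<noteq> 0} \<subseteq> {s. fls_nth f s \<noteq> 0} \<union> {s. fls_nth g s \<noteq> 0}"
    by auto
  then show ?thesis
    using assms by (auto simp: nonneg_laurent_poly_def intro: finite_subset)
qed

lemma nonneg_laurent_poly_mult:
  assumes "nonneg_laurent_poly f" "nonneg_laurent_poly g"
  shows "nonneg_laurent_poly (f * g)"
proof -
  have "{s. fls_nth (f * g) s \<noteq> 0} \<subseteq>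
      (\<lambda>(a, b). a + b) ` ({s. fls_nth f s \<noteq> 0} \<times> {s. fls_nth g s \<noteq> 0})"
  proof
    fix s assume "s \<in> {s. fls_nth (f * g) s \<noteq> 0}"
    then have "(\<Sum>i=fls_subdegree f..s - fls_subdegree g. fls_nth f i * fls_nth g (s - i)) \<noteq> 0"
      by (simp add: fls_times_nth(2))
    then obtain i where "fls_nth f i * fls_nth g (s - i) \<noteq> 0"
      by (meson sum.neutral)
    then show "s \<in> (\<lambda>(a, b). a + b) ` ({s. fls_nth f s \<noteq> 0} \<times> {s. fls_nth g s \<noteq> 0})"
      by (intro image_eqI[of _ _ "(i, s - i)"]) auto
  qed
  moreover have "fls_nth (f * g) s \<ge> 0" for s
    using assms by (auto simp: fls_times_nth(2) nonneg_laurent_poly_def intro!: sum_nonneg)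
  ultimately show ?thesis
    using assms by (auto simp: nonneg_laurent_poly_def intro: finite_subset)
qed

lemma nonneg_laurent_poly_sum:
  "(\<And>i. i \<in> A \<Longrightarrow> nonneg_laurent_poly (f i)) \<Longrightarrow> nonneg_laurent_poly (sum f A)"
  by (induction A rule: infinite_finite_induct)
    (auto intro: nonneg_laurent_poly_0 nonneg_laurent_poly_add)

lemma nonneg_laurent_poly_power:
  "nonneg_laurent_poly f \<Longrightarrow> nonneg_laurent_poly (f ^ n)"
  by (induction n) (auto intro: nonneg_laurent_poly_1 nonneg_laurent_poly_mult)

lemma nonneg_laurent_poly_X_powi: "nonneg_laurent_poly (fls_X powi i)"
proof -
  have "{s::int. s = i} = {i}" by auto
  then show ?thesis
    by (auto simp: nonneg_laurent_poly_def fls_X_power_int)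
qed

lemma nonneg_laurent_poly_add_nonzero:
  assumes "nonneg_laurent_poly f" "nonneg_laurent_poly g" "f \<noteq> 0"
  shows "f + g \<noteq> 0"
proof -
  obtain s where "fls_nth f s \<noteq> 0"
    using \<open>f \<noteq> 0\<close> by (auto simp: fls_eq_iff)
  then have "fls_nth f s > 0" "fls_nth g s \<ge> 0"
    using assms by (auto simp: nonneg_laurent_poly_def order_less_le)
  then have "fls_nth (f + g) s \<noteq> fls_nth 0 s"
    by simp
  then show ?thesis
    by metis
qed

lemma laurent_poly_eval_1_pos:
  assumes "nonneg_laurent_poly f" "f \<noteq> 0"
  shows "laurent_poly_eval f 1 > 0"
proof -
  have "{s. fls_nth f s \<noteq> 0} \<noteq> {}"
    using \<open>f \<noteq> 0\<close> by (auto simp: fls_eq_iff)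
  then have "(\<Sum>s | fls_nth f s \<noteq> 0. fls_nth f s) > 0"
    using assms by (intro sum_pos) (auto simp: nonneg_laurent_poly_def order_less_le)
  then show ?thesis
    by (simp add: laurent_poly_eval_def)
qed

definition nonneg_unit_fps :: "real fls fps \<Rightarrow> bool" where
  "nonneg_unit_fps F \<longleftrightarrow> fps_nth F 0 = 1 \<and> (\<forall>n. nonneg_laurent_poly (fps_nth F n))"

lemma nonneg_unit_fps_1: "nonneg_unit_fps 1"
  by (simp add: nonneg_unit_fps_def nonneg_laurent_poly_0 nonneg_laurent_poly_1)

lemma nonneg_unit_fps_mult:
  "nonneg_unit_fps F \<Longrightarrow> nonneg_unit_fps G \<Longrightarrow> nonneg_unit_fps (F * G)"
  by (auto simp: nonneg_unit_fps_def fps_mult_nth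
      intro!: nonneg_laurent_poly_sum nonneg_laurent_poly_mult)

lemma nonneg_unit_fps_prod:
  "(\<And>i. i \<in> A \<Longrightarrow> nonneg_unit_fps (f i)) \<Longrightarrow> nonneg_unit_fps (prod f A)"
  by (induction A rule: infinite_finite_induct)
    (auto intro: nonneg_unit_fps_1 nonneg_unit_fps_mult)

lemma nonneg_unit_fps_mult_nonzero:
  assumes "nonneg_unit_fps F" "nonneg_unit_fps G" "fps_nth F n \<noteq> 0"
  shows "fps_nth (F * G) n \<noteq> 0"
proof -
  have "fps_nth (F * G) n = fps_nth F n + (\<Sum>i\<in>{0..n} - {n}. fps_nth F i * fps_nth G (n - i))"
    using assms(2) by (subst fps_mult_nth, subst sum.remove[of _ n])
      (auto simp: nonneg_unit_fps_def)
  also have "\<dots> \<noteq> 0"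
    using assms by (intro nonneg_laurent_poly_add_nonzero nonneg_laurent_poly_sum
        nonneg_laurent_poly_mult) (auto simp: nonneg_unit_fps_def)
  finally show ?thesis .
qed

lemma inverse_one_minus_const_X_power:
  fixes c :: "real fls"
  assumes "m > 0"
  shows "inverse (1 - fps_const c * fps_X ^ m) =
    Abs_fps (\<lambda>n. if m dvd n then c ^ (n div m) else 0)" (is "_ = ?G")
proof (rule fps_inverse_unique)
  have "?G - fps_const c * (fps_X ^ m * ?G) = 1"
  proof (rule fps_ext)
    fix n
    have "c ^ (n div m) = c * c ^ ((n - m) div m)" if "n \<ge> m"
      using assms that by (simp add: le_div_geq)
    moreover have "m dvd n - m \<longleftrightarrow> m dvd n" if "n \<ge> m"
      using that by (simp add: dvd_minus_self)
    moreover have "m dvd n \<longleftrightarrow> n = 0" if "n < m"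
      using that by (auto dest: dvd_imp_le)
    ultimately show "fps_nth (?G - fps_const c * (fps_X ^ m * ?G)) n = fps_nth 1 n"
      using assms by (cases "n < m") (auto simp: fps_X_power_mult_nth)
  qed
  then show "(1 - fps_const c * fps_X ^ m) * ?G = 1"
    by (simp add: algebra_simps)
qed

lemma nonneg_unit_fps_inverse:
  assumes "m > 0" "nonneg_laurent_poly c"
  shows "nonneg_unit_fps (inverse (1 - fps_const c * fps_X ^ m))"
  using assms by (auto simp: inverse_one_minus_const_X_power nonneg_unit_fps_def
      intro: nonneg_laurent_poly_power nonneg_laurent_poly_0)

lemma nonneg_unit_fps_DT_factor: "m > 0 \<Longrightarrow> nonneg_unit_fps (DT_factor r m)"
  unfolding DT_factor_def
  by (intro nonneg_unit_fps_prod nonneg_unit_fps_inverse nonneg_laurent_poly_X_powi)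

lemma fps_mult_nth_trivial:
  assumes "fps_nth G 0 = 1" "\<And>j. 0 < j \<Longrightarrow> j < m \<Longrightarrow> fps_nth G j = 0" "n < m"
  shows "fps_nth (F * G :: 'a :: comm_ring_1 fps) n = fps_nth F n"
proof -
  have "fps_nth (F * G) n = (\<Sum>i=0..n. if i = n then fps_nth F n else 0)"
    unfolding fps_mult_nth using assms by (intro sum.cong) auto
  then show ?thesis by simp
qed

lemma DT_factor_nth:
  assumes "0 < j" "j < m"
  shows "fps_nth (DT_factor r m) j = 0"
proof -
  have "fps_nth (\<Prod>k<N. inverse (1 - fps_const (f k :: real fls) * fps_X ^ m)) j = fps_nth 1 j"
    for N :: nat and f
  proof (induction N)
    case (Suc N)
    show ?case
      unfolding prod.lessThan_Suc using assms Suc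
      by (subst fps_mult_nth_trivial[where m = m])
        (auto simp: inverse_one_minus_const_X_power dest: dvd_imp_le)
  qed simp
  then show ?thesis
    using assms by (simp add: DT_factor_def)
qed

lemma DT_partial_product_stable:
  assumes "n \<le> N"
  shows "fps_nth (\<Prod>m\<le>N. DT_factor r (Suc m)) n = fps_nth (\<Prod>m\<le>n. DT_factor r (Suc m)) n"
  using assms
proof (induction N rule: dec_induct)
  case (step N)
  have "fps_nth (DT_factor r (Suc (Suc N))) 0 = 1"
    using nonneg_unit_fps_DT_factor[of "Suc (Suc N)" r] by (simp add: nonneg_unit_fps_def)
  then have "fps_nth (\<Prod>m\<le>Suc N. DT_factor r (Suc m)) n = fps_nth (\<Prod>m\<le>N. DT_factor r (Suc m)) n"
    unfolding prod.atMost_Suc using step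
    by (subst fps_mult_nth_trivial[where m = "Suc (Suc N)"]) (auto simp: DT_factor_nth)
  with step show ?case by simp
qed simp

lemma has_prod_DT_points: "(\<lambda>m. DT_factor r (Suc m)) has_prod DT_points r"
  and DT_coeff_eq: "DT_coeff n r = fps_nth (\<Prod>m\<le>n. DT_factor r (Suc m)) n"
proof -
  define L where "L = Abs_fps (\<lambda>n. fps_nth (\<Prod>m\<le>n. DT_factor r (Suc m)) n)"
  have "(\<lambda>N. \<Prod>m\<le>N. DT_factor r (Suc m)) \<longlonglongrightarrow> L"
    unfolding tendsto_fps_iff L_def
    by (auto intro!: eventually_sequentiallyI DT_partial_product_stable)
  moreover have "fps_nth L 0 = 1"
    using nonneg_unit_fps_DT_factor[of 1 r] by (simp add: L_def nonneg_unit_fps_def)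
  then have "L \<noteq> 0" by auto
  ultimately have *: "(\<lambda>m. DT_factor r (Suc m)) has_prod L"
    by (simp add: has_prod_def raw_has_prod_def)
  then have "DT_points r = L"
    unfolding DT_points_def by (metis has_prod_unique)
  with * show "(\<lambda>m. DT_factor r (Suc m)) has_prod DT_points r"
    and "DT_coeff n r = fps_nth (\<Prod>m\<le>n. DT_factor r (Suc m)) n"
    by (simp_all add: DT_coeff_def L_def)
qed

lemma nonneg_laurent_poly_DT_coeff: "nonneg_laurent_poly (DT_coeff n r)"
proof -
  have "nonneg_unit_fps (\<Prod>m\<le>n. DT_factor r (Suc m))"
    by (intro nonneg_unit_fps_prod nonneg_unit_fps_DT_factor) simp
  then show ?thesis
    by (simp add: DT_coeff_eq nonneg_unit_fps_def)
qed

lemma DT_coeff_nonzero: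
  assumes "r \<ge> 1"
  shows "DT_coeff n r \<noteq> 0"
proof -
  let ?c = "\<lambda>k. fls_X powi (4 + 2 * int k - int r) :: real fls"
  let ?g = "\<lambda>k. inverse (1 - fps_const (?c k) * fps_X ^ 1) :: real fls fps"
  have g: "nonneg_unit_fps (?g k)" for k
    by (intro nonneg_unit_fps_inverse nonneg_laurent_poly_X_powi) simp
  have "fps_nth (?g 0) n \<noteq> 0"
    by (subst inverse_one_minus_const_X_power) (simp_all add: power_int_not_zero del: fls_X_power_int)
  then have "fps_nth (?g 0 * (\<Prod>k\<in>{..<r} - {0}. ?g k)) n \<noteq> 0"
    by (intro nonneg_unit_fps_mult_nonzero nonneg_unit_fps_prod g)
  also have "?g 0 * (\<Prod>k\<in>{..<r} - {0}. ?g k) = DT_factor r 1"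
    using assms unfolding DT_factor_def by (subst prod.remove[of "{..<r * 1}" 0]) auto
  finally have "fps_nth (DT_factor r 1) n \<noteq> 0" .
  then have "fps_nth (DT_factor r 1 * (\<Prod>m\<in>{..n} - {0}. DT_factor r (Suc m))) n \<noteq> 0"
    by (intro nonneg_unit_fps_mult_nonzero nonneg_unit_fps_prod nonneg_unit_fps_DT_factor) auto
  also have "DT_factor r 1 * (\<Prod>m\<in>{..n} - {0}. DT_factor r (Suc m)) = (\<Prod>m\<le>n. DT_factor r (Suc m))"
    by (subst (2) prod.remove[of _ 0]) auto
  finally show ?thesis
    by (simp add: DT_coeff_eq)
qed

text \<open>The coefficients, normalised by the value at \<open>1\<close>, are the mass function of a law on the
  integers, so integer-valued random variables with this law exist.\<close>

lemma DT_coeff_distribution_exists: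
  assumes "r \<ge> 1"
  shows "\<exists>p. \<forall>s. pmf p s = fls_nth (DT_coeff n r) s / laurent_poly_eval (DT_coeff n r) 1"
proof -
  let ?f = "DT_coeff n r"
  let ?w = "\<lambda>s. fls_nth ?f s / laurent_poly_eval ?f 1"
  let ?A = "{s. fls_nth ?f s \<noteq> 0}"
  have f: "nonneg_laurent_poly ?f" by (rule nonneg_laurent_poly_DT_coeff)
  have pos: "laurent_poly_eval ?f 1 > 0"
    using f DT_coeff_nonzero[OF assms] by (rule laurent_poly_eval_1_pos)
  have fin: "finite ?A" and nonneg: "?w s \<ge> 0" for s
    using f pos by (auto simp: nonneg_laurent_poly_def)
  have "(\<Sum>s\<in>?A. ?w s) = 1"
    using pos by (simp add: laurent_poly_eval_def flip: sum_divide_distrib)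
  then have "(\<integral>\<^sup>+s. ennreal (?w s) \<partial>count_space UNIV) = 1"
    using fin nonneg by (subst nn_integral_count_space'[of ?A]) (auto simp: sum_ennreal)
  then have "\<forall>s. pmf (embed_pmf ?w) s = ?w s"
    using nonneg by (auto intro: pmf_embed_pmf)
  then show ?thesis by blast
qed

end

theory Submission
  imports Defs "HOL-Real_Asymp.Real_Asymp"
begin

text \<open>
  Put \<open>q = e\<^sup>-\<^sup>t\<close> with \<open>t = (2 r \<zeta>(3) / n)\<^bsup>1/3\<^esup>\<close>. The product then describes independent geometric
  variables \<open>X\<^sub>m\<^sub>k\<close> with parameter \<open>e\<^bsup>-tm\<^esup>\<close>, and the law of \<open>S\<close> is that of \<open>\<Sum> (4 + 2k - rm) X\<^sub>m\<^sub>k\<close> conditioned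
  on \<open>\<Sum> m X\<^sub>m\<^sub>k = n\<close>. Extracting the coefficient of \<open>q ^ n\<close> by Cauchy's formula on \<open>\<bar>q\<bar> = e\<^sup>-\<^sup>t\<close> turns the
  characteristic function of \<open>n\<^bsup>-2/3\<^esup> S\<close> into a quotient of two integrals over the angle \<open>\<phi> = t\<^sup>2 u\<close>.
  For fixed \<open>u\<close> a third-order expansion of the logarithm of the geometric characteristic function
  gives a Gaussian limit of the integrand; its constants come from expanding
  \<open>1 / (e\<^bsup>tm\<^esup> - 1) = \<Sum>\<^sub>j e\<^bsup>-tmj\<^esup>\<close> and interchanging sums, so that \<open>\<zeta>(2)\<close> and \<open>\<zeta>(3)\<close> appear by Tannery's theorem.
  The factors with \<open>m \<le> 1/t\<close> bound the integrand by a multiple of \<open>e\<^bsup>-c\<bar>u\<bar>\<^esup>\<close> on the whole circle, so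
  dominated convergence and Levy's continuity theorem apply.
\<close>

subsection \<open>Evaluation of Laurent polynomials at complex numbers\<close>

text \<open>The radius is the saddle point to leading order only: under the geometric variables the
  size \<open>\<Sum> m X\<close> has mean asymptotic to 2 r \<zeta>(3) / t^3 = n. This precision
  suffices because the expansion of that mean has no term of order t^-2, while in the phase the
  deviation from n is multiplied by t^2 u. The size has variance about 6 r \<zeta>(3) / t^4, which
  dictates the scale \<phi> = t^2 u; the angle of T is b t^2 with a constant b. The covariance of
  size and weight is at most of order t^-3, so in the limit the factors in u and b separate:
  conditioning on the size costs no variance, and the integral over u cancels in the quotient. No
  asymptotic formula for the number of tuples is needed. The obstacle is uniformity: the expansion
  controls bounded u only, whereas the circle reaches |u| = pi / t^2. Far from the real axis the
  decay must come from equidistribution of the angles \<phi> m, and the perturbation by the angle of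
  T must not destroy it.\<close>

definition laurent_evalc :: "real fls \<Rightarrow> complex \<Rightarrow> complex" where
  "laurent_evalc f z = (\<Sum>s | fls_nth f s \<noteq> 0. of_real (fls_nth f s) * z powi s)"

lemma laurent_evalc_superset:
  assumes "finite A" "{s. fls_nth f s \<noteq> 0} \<subseteq> A"
  shows "laurent_evalc f z = (\<Sum>s\<in>A. of_real (fls_nth f s) * z powi s)"
  unfolding laurent_evalc_def using assms by (intro sum.mono_neutral_left) auto

lemma laurent_evalc_0 [simp]: "laurent_evalc 0 z = 0"
  by (simp add: laurent_evalc_def)

lemma laurent_evalc_X_powi: "laurent_evalc (fls_X powi i) z = z powi i"
  by (subst laurent_evalc_superset[of "{i}"]) (auto simp: fls_X_power_int)

lemma laurent_evalc_1 [simp]: "laurent_evalc 1 z = 1"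
  using laurent_evalc_X_powi[of 0 z] by simp

lemma laurent_evalc_add:
  assumes "nonneg_laurent_poly f" "nonneg_laurent_poly g"
  shows "laurent_evalc (f + g) z = laurent_evalc f z + laurent_evalc g z"
proof -
  define A where "A = {s. fls_nth f s \<noteq> 0} \<union> {s. fls_nth g s \<noteq> 0}"
  have A: "finite A"
    using assms by (simp add: A_def nonneg_laurent_poly_def)
  show ?thesis
    by (subst (1 2 3) laurent_evalc_superset[OF A])
      (auto simp: A_def algebra_simps sum.distrib)
qed

lemma laurent_evalc_sum:
  assumes "\<And>i. i \<in> A \<Longrightarrow> nonneg_laurent_poly (f i)"
  shows "laurent_evalc (sum f A) z = (\<Sum>i\<in>A. laurent_evalc (f i) z)"
  using assms
  by (induction A rule: infinite_finite_induct)
    (auto simp: laurent_evalc_add nonneg_laurent_poly_sum)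

text \<open>Over the finite sumset \<open>C\<close> of the two supports the convolution is an
  ordinary double sum that can be swapped. The hypothesis \<open>z \<noteq> 0\<close> lets
  \<open>z powi s\<close> split as \<open>z powi i * z powi (s - i)\<close> for exponents of either
  sign.\<close>

lemma laurent_evalc_mult:
  assumes f: "nonneg_laurent_poly f" and g: "nonneg_laurent_poly g" and z: "z \<noteq> 0"
  shows "laurent_evalc (f * g) z = laurent_evalc f z * laurent_evalc g z"
proof -
  define A where "A = {s. fls_nth f s \<noteq> 0}"
  define B where "B = {s. fls_nth g s \<noteq> 0}"
  define C where "C = (\<lambda>(a, b). a + b) ` (A \<times> B)"
  have fin: "finite A" "finite B" "finite C"
    using f g by (auto simp: A_def B_def C_def nonneg_laurent_poly_def)
  have nth: "fls_nth (f * g) s = (\<Sum>i\<in>A. fls_nth f i * fls_nth g (s - i))" for s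
  proof -
    \<comment> \<open>The convolution is given over an interval bounded by the subdegrees. Every
      nonzero term lies both in that interval and in the support \<open>A\<close>, so either index
      set may replace the other.\<close>
    have "i \<in> {fls_subdegree f..s - fls_subdegree g}"
      if "fls_nth f i * fls_nth g (s - i) \<noteq> 0" for i
      using that fls_subdegree_leI[of f i] fls_subdegree_leI[of g "s - i"] by auto
    then have "(\<Sum>i=fls_subdegree f..s - fls_subdegree g. fls_nth f i * fls_nth g (s - i)) =
        (\<Sum>i\<in>A \<inter> {fls_subdegree f..s - fls_subdegree g}. fls_nth f i * fls_nth g (s - i))"
      by (intro sum.mono_neutral_right) (auto simp: A_def)
    also have "\<dots> = (\<Sum>i\<in>A. fls_nth f i * fls_nth g (s - i))"
      using \<open>\<And>i. fls_nth f i * fls_nth g (s - i) \<noteq> 0 \<Longrightarrow> _ i\<close> fin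
      by (intro sum.mono_neutral_left) auto
    finally show ?thesis
      by (simp add: fls_times_nth(2))
  qed
  have "{s. fls_nth (f * g) s \<noteq> 0} \<subseteq> C"
  proof
    fix s assume "s \<in> {s. fls_nth (f * g) s \<noteq> 0}"
    then obtain i where "i \<in> A" "fls_nth f i * fls_nth g (s - i) \<noteq> 0"
      unfolding nth by (auto elim: sum.not_neutral_contains_not_neutral)
    then show "s \<in> C"
      unfolding C_def B_def by (intro image_eqI[of _ _ "(i, s - i)"]) auto
  qed
  then have "laurent_evalc (f * g) z = (\<Sum>s\<in>C. \<Sum>i\<in>A. of_real (fls_nth f i) * of_real (fls_nth g (s - i)) * z powi s)"
    using fin by (simp add: laurent_evalc_superset[of C] nth sum_distrib_right)
  also have "\<dots> = (\<Sum>i\<in>A. \<Sum>s\<in>C. of_real (fls_nth f i) * of_real (fls_nth g (s - i)) * z powi s)"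
    by (rule sum.swap)
  also have "\<dots> = (\<Sum>i\<in>A. (of_real (fls_nth f i) * z powi i) * laurent_evalc g z)"
  proof (intro sum.cong refl)
    fix i assume i: "i \<in> A"
    have "laurent_evalc g z = (\<Sum>j\<in>(\<lambda>s. s - i) ` C. of_real (fls_nth g j) * z powi j)"
    proof (rule laurent_evalc_superset)
      show "{s. fls_nth g s \<noteq> 0} \<subseteq> (\<lambda>s. s - i) ` C"
      proof
        fix j assume "j \<in> {s. fls_nth g s \<noteq> 0}"
        then have "i + j \<in> C"
          unfolding C_def B_def using i by (intro image_eqI[of _ _ "(i, j)"]) auto
        then show "j \<in> (\<lambda>s. s - i) ` C"
          by (intro image_eqI[of _ _ "i + j"]) auto
      qed
    qed (use fin in simp)
    also have "\<dots> = (\<Sum>s\<in>C. of_real (fls_nth g (s - i)) * z powi (s - i))"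
      by (subst sum.reindex) (auto simp: inj_on_def)
    finally have "of_real (fls_nth f i) * z powi i * laurent_evalc g z =
        (\<Sum>s\<in>C. of_real (fls_nth f i) * of_real (fls_nth g (s - i)) * (z powi i * z powi (s - i)))"
      by (simp add: sum_distrib_left mult_ac)
    then show "(\<Sum>s\<in>C. of_real (fls_nth f i) * of_real (fls_nth g (s - i)) * z powi s) =
        of_real (fls_nth f i) * z powi i * laurent_evalc g z"
      using z by (simp flip: power_int_add)
  qed
  also have "\<dots> = laurent_evalc f z * laurent_evalc g z"
    by (simp add: laurent_evalc_def A_def sum_distrib_right)
  finally show ?thesis .
qed

lemma laurent_evalc_power:
  assumes "nonneg_laurent_poly f" "z \<noteq> 0"
  shows "laurent_evalc (f ^ n) z = laurent_evalc f z ^ n"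
  using assms by (induction n) (auto simp: laurent_evalc_mult nonneg_laurent_poly_power)

definition laurent_evalc_fps :: "real fls fps \<Rightarrow> complex \<Rightarrow> complex fps" where
  "laurent_evalc_fps F z = Abs_fps (\<lambda>n. laurent_evalc (fps_nth F n) z)"

lemma laurent_evalc_fps_1 [simp]: "laurent_evalc_fps 1 z = 1"
  by (rule fps_ext) (simp add: laurent_evalc_fps_def)

lemma laurent_evalc_fps_mult:
  assumes "nonneg_unit_fps F" "nonneg_unit_fps G" "z \<noteq> 0"
  shows "laurent_evalc_fps (F * G) z = laurent_evalc_fps F z * laurent_evalc_fps G z"
  using assms unfolding nonneg_unit_fps_def
  by (intro fps_ext)
    (simp add: laurent_evalc_fps_def fps_mult_nth laurent_evalc_sum laurent_evalc_mult nonneg_laurent_poly_mult)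

lemma laurent_evalc_fps_prod:
  assumes "\<And>i. i \<in> A \<Longrightarrow> nonneg_unit_fps (f i)" "z \<noteq> 0"
  shows "laurent_evalc_fps (prod f A) z = (\<Prod>i\<in>A. laurent_evalc_fps (f i) z)"
  using assms
  by (induction A rule: infinite_finite_induct)
    (auto simp: laurent_evalc_fps_mult nonneg_unit_fps_prod)

text \<open>The expansion of 1 / (1 - c q^m), given by coefficients so that
  \<open>norm c \<le> 1\<close> bounds them all by 1.\<close>

definition geom_fps :: "complex \<Rightarrow> nat \<Rightarrow> complex fps" where
  "geom_fps c m = Abs_fps (\<lambda>n. if m dvd n then c ^ (n div m) else 0)"

lemma laurent_evalc_fps_inverse:
  assumes "m > 0" "nonneg_laurent_poly c" "z \<noteq> 0"
  shows "laurent_evalc_fps (inverse (1 - fps_const c * fps_X ^ m)) z = geom_fps (laurent_evalc c z) m"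
  using assms
  by (intro fps_ext) (simp add: laurent_evalc_fps_def geom_fps_def inverse_one_minus_const_X_power laurent_evalc_power)

lemma fps_conv_radius_geom_fps:
  assumes "norm c \<le> 1"
  shows "fps_conv_radius (geom_fps c m) \<ge> 1"
proof -
  have "summable (\<lambda>n. fps_nth (geom_fps c m) n * of_real x ^ n)" if "0 < x" "x < 1" for x :: real
  proof (rule summable_comparison_test')
    show "summable (\<lambda>n. x ^ n)"
      using that by (intro summable_geometric) auto
    show "norm (fps_nth (geom_fps c m) n * of_real x ^ n) \<le> x ^ n" for n
      using that assms power_le_one[of "norm c" "n div m"]
      by (auto simp: geom_fps_def norm_mult norm_power mult_le_cancel_right1)
  qed
  then show ?thesis
    unfolding fps_conv_radius_def
    by (intro conv_radius_geI_ex'[of 1, simplified]) (auto simp: one_ereal_def)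
qed

text \<open>Evaluation is multiplicative inside the radius of convergence, so it is enough that the
  series times the polynomial \<open>1 - c X^m\<close> is 1. The same identity shows that the
  denominator does not vanish.\<close>

lemma eval_fps_geom_fps:
  assumes "norm c \<le> 1" "norm z < 1" "m > 0"
  shows "eval_fps (geom_fps c m) z = 1 / (1 - c * z ^ m)"
proof -
  have r: "ereal (norm z) < fps_conv_radius (geom_fps c m)"
    using fps_conv_radius_geom_fps[OF assms(1), of m] assms(2)
    by (meson ereal_less(3) less_le_trans)
  have "(1 - fps_const c * fps_X ^ m) * geom_fps c m = 1"
  proof (rule fps_ext)
    fix n
    have "c ^ (n div m) = c * c ^ ((n - m) div m)" if "n \<ge> m"
      using assms that by (simp add: le_div_geq)
    moreover have "m dvd n - m \<longleftrightarrow> m dvd n" if "n \<ge> m"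
      using that by (simp add: dvd_minus_self)
    moreover have "m dvd n \<longleftrightarrow> n = 0" if "n < m"
      using that by (auto dest: dvd_imp_le)
    ultimately show "fps_nth ((1 - fps_const c * fps_X ^ m) * geom_fps c m) n = fps_nth 1 n"
      using assms by (cases "n < m")
        (auto simp: geom_fps_def fps_X_power_mult_nth algebra_simps mult.assoc)
  qed
  moreover have k: "fps_conv_radius (fps_const c * fps_X ^ m) = \<infinity>"
    using fps_conv_radius_mult[of "fps_const c" "fps_X ^ m"] by simp
  moreover have "fps_conv_radius (1 - fps_const c * fps_X ^ m) = \<infinity>"
    using fps_conv_radius_diff[of 1 "fps_const c * fps_X ^ m"] k by simp
  moreover have "eval_fps (1 - fps_const c * fps_X ^ m) z = 1 - c * z ^ m"
    using k by (simp add: eval_fps_diff eval_fps_mult)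
  ultimately have "(1 - c * z ^ m) * eval_fps (geom_fps c m) z = 1"
    using r eval_fps_mult[of z "1 - fps_const c * fps_X ^ m" "geom_fps c m"] by simp
  then show ?thesis
    by (metis mult_eq_0_iff nonzero_eq_divide_eq mult.commute zero_neq_one)
qed

subsection \<open>Coefficient extraction\<close>

lemma has_integral_cis_period:
  fixes j :: int
  shows "((\<lambda>x. cis (of_int j * x)) has_integral (if j = 0 then 2 * pi else 0)) {-pi..pi}"
proof (cases "j = 0")
  case True
  have "((\<lambda>x. 1 :: complex) has_integral (pi - (-pi)) *\<^sub>R 1) {-pi..pi}"
    using has_integral_const_real[of "1::complex" "-pi" pi] by simp
  with True show ?thesis
    by (simp add: scaleR_conv_of_real)
next
  case False
  have "((\<lambda>x. cis (of_int j * x)) has_integral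
      (cis (of_int j * pi) / (\<i> * of_int j) - cis (of_int j * (-pi)) / (\<i> * of_int j))) {-pi..pi}"
  proof (rule fundamental_theorem_of_calculus)
    fix x :: real
    have "((\<lambda>x. cis (of_int j * x)) has_vector_derivative (of_int j * (\<i> * cis (of_int j * x))))
        (at x within {-pi..pi})"
    proof -
      have "((\<lambda>z. exp (\<i> * (of_int j * z))) has_field_derivative
          (of_int j * (\<i> * exp (\<i> * (of_int j * of_real x))))) (at (of_real x))"
        by (auto intro!: derivative_eq_intros)
      from has_vector_derivative_real_field[OF this] show ?thesis
        unfolding cis_conv_exp of_real_mult of_real_of_int_eq .
    qed
    then show "((\<lambda>x. cis (of_int j * x) / (\<i> * of_int j)) has_vector_derivative cis (of_int j * x))
        (at x within {-pi..pi})"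
      using False by (auto dest: has_vector_derivative_divide[of _ _ _ "\<i> * of_int j"])
  qed simp
  moreover have "cis (of_int j * pi) = cis (of_int j * (-pi))"
    using sin_zero_iff_int2[of "of_int j * pi"] by (auto simp: complex_eq_iff)
  ultimately show ?thesis
    using False by simp
qed

lemma integral_cis_period:
  fixes j :: int
  shows "(LINT x:{-pi..pi}|lborel. cis (of_int j * x)) = (if j = 0 then 2 * pi else 0)"
proof -
  have "set_integrable lborel {-pi..pi} (\<lambda>x. cis (of_int j * x))"
    by (intro borel_integrable_atLeastAtMost' continuous_intros)
  from set_borel_integral_eq_integral(2)[OF this] show ?thesis
    using has_integral_cis_period[of j] by (simp add: integral_unique)
qed

text \<open>Cauchy's formula by termwise integration: orthogonality of the functions
  \<open>cis (j * x)\<close> leaves only the term \<open>k = n\<close>, and absolute convergence at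
  radius \<open>\<rho> < 1\<close> justifies the exchange.\<close>

lemma fps_nth_integral:
  fixes F :: "complex fps"
  assumes F: "fps_conv_radius F \<ge> 1" and \<rho>: "0 < \<rho>" "\<rho> < 1"
  shows "(LINT x:{-pi..pi}|lborel. eval_fps F (of_real \<rho> * cis x) * cis (- (real n * x))) =
    2 * pi * fps_nth F n * of_real \<rho> ^ n"
proof -
  define f where "f k x = indicator {-pi..pi} x *\<^sub>R
      (fps_nth F k * of_real \<rho> ^ k * cis (of_int (int k - int n) * x))" for k and x :: real
  have r: "ereal (norm (of_real \<rho> * cis x :: complex)) < fps_conv_radius F" for x
  proof -
    have "ereal (norm (of_real \<rho> * cis x :: complex)) < 1"
      using \<rho> by (simp add: norm_mult one_ereal_def)
    then show ?thesis
      using F by (rule less_le_trans)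
  qed
  have sumr: "summable (\<lambda>k. norm (fps_nth F k) * \<rho> ^ k)"
    using norm_summable_fps[OF r[of 0]] \<rho> by (simp add: norm_mult norm_power)
  have int: "integrable lborel (f k)" for k
    unfolding f_def
    by (rule borel_integrable_atLeastAtMost'[unfolded set_integrable_def]) (intro continuous_intros)
  have nf: "norm (f k x) = indicator {-pi..pi} x * (norm (fps_nth F k) * \<rho> ^ k)" for k x
    using \<rho> by (simp add: f_def norm_mult norm_power)
  have val: "integral\<^sup>L lborel (f k) = (if k = n then 2 * pi * fps_nth F n * of_real \<rho> ^ n else 0)" for k
  proof -
    have "integral\<^sup>L lborel (\<lambda>x. f k x) =
        (LINT x:{-pi..pi}|lborel. fps_nth F k * of_real \<rho> ^ k * cis (of_int (int k - int n) * x))"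
      unfolding f_def set_lebesgue_integral_def ..
    also have "\<dots> = fps_nth F k * of_real \<rho> ^ k * (LINT x:{-pi..pi}|lborel. cis (of_int (int k - int n) * x))"
      by (rule set_integral_mult_right)
    finally show ?thesis
      unfolding integral_cis_period by auto
  qed
  have "(LINT x:{-pi..pi}|lborel. eval_fps F (of_real \<rho> * cis x) * cis (- (real n * x))) =
      (LINT x|lborel. (\<Sum>k. f k x))"
    unfolding set_lebesgue_integral_def
  proof (intro Bochner_Integration.integral_cong refl)
    fix x
    have "(\<lambda>k. fps_nth F k * (of_real \<rho> * cis x) ^ k) sums eval_fps F (of_real \<rho> * cis x)"
      using r by (rule sums_eval_fps)
    then have "(\<lambda>k. indicator {-pi..pi} x *\<^sub>R (fps_nth F k * (of_real \<rho> * cis x) ^ k * cis (- (real n * x)))) sums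
       (indicator {-pi..pi} x *\<^sub>R (eval_fps F (of_real \<rho> * cis x) * cis (- (real n * x))))"
      by (intro sums_scaleR_right sums_mult2)
    moreover have "indicator {-pi..pi} x *\<^sub>R (fps_nth F k * (of_real \<rho> * cis x) ^ k * cis (- (real n * x))) = f k x" for k
    proof -
      have "cis x ^ k * cis (- (real n * x)) = cis (of_int (int k - int n) * x)"
        by (simp add: Complex.DeMoivre cis_mult left_diff_distrib)
      then show ?thesis
        by (simp add: f_def power_mult_distrib mult.assoc)
    qed
    ultimately show "indicator {-pi..pi} x *\<^sub>R (eval_fps F (of_real \<rho> * cis x) * cis (- (real n * x))) = (\<Sum>k. f k x)"
      by (simp add: sums_iff)
  qed
  also have "\<dots> = (\<Sum>k. integral\<^sup>L lborel (f k))"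
  proof (rule integral_suminf[OF int])
    show "AE x in lborel. summable (\<lambda>k. norm (f k x))"
      unfolding nf by (intro AE_I2 summable_mult sumr)
    show "summable (\<lambda>k. LINT x|lborel. norm (f k x))"
      unfolding nf using sumr by (simp add: summable_mult)
  qed
  also have "\<dots> = 2 * pi * fps_nth F n * of_real \<rho> ^ n"
    unfolding val by (rule sums_unique[symmetric, OF sums_single])
  finally show ?thesis .
qed

lemma fps_conv_radius_prod:
  fixes f :: "'b \<Rightarrow> complex fps"
  assumes "\<And>i. i \<in> A \<Longrightarrow> fps_conv_radius (f i) \<ge> R"
  shows "fps_conv_radius (prod f A) \<ge> R"
  using assms
proof (induction A rule: infinite_finite_induct)
  case (insert x A)
  then have "R \<le> min (fps_conv_radius (f x)) (fps_conv_radius (prod f A))" by auto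
  also have "\<dots> \<le> fps_conv_radius (f x * prod f A)" by (rule fps_conv_radius_mult)
  finally show ?case using insert by simp
qed auto

lemma eval_fps_prod:
  fixes f :: "'b \<Rightarrow> complex fps"
  assumes "\<And>i. i \<in> A \<Longrightarrow> fps_conv_radius (f i) \<ge> R" "ereal (norm z) < R"
  shows "eval_fps (prod f A) z = (\<Prod>i\<in>A. eval_fps (f i) z)"
  using assms(1)
proof (induction A rule: infinite_finite_induct)
  case (insert x A)
  then have "ereal (norm z) < fps_conv_radius (f x)" "ereal (norm z) < fps_conv_radius (prod f A)"
    using assms(2) fps_conv_radius_prod[of A R f] by (auto intro: less_le_trans)
  then show ?case using insert by (simp add: eval_fps_mult)
qed auto

definition weight :: "nat \<Rightarrow> nat \<Rightarrow> nat \<Rightarrow> int" where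
  "weight r m k = 4 + 2 * int k - int (r * m)"

lemma laurent_evalc_fps_DT_factor:
  assumes "m > 0" "z \<noteq> 0"
  shows "laurent_evalc_fps (DT_factor r m) z = (\<Prod>k<r * m. geom_fps (z powi weight r m k) m)"
proof -
  have "laurent_evalc_fps (DT_factor r m) z =
      (\<Prod>k<r * m. laurent_evalc_fps (inverse (1 - fps_const (fls_X powi weight r m k) * fps_X ^ m)) z)"
    unfolding DT_factor_def weight_def
    by (intro laurent_evalc_fps_prod nonneg_unit_fps_inverse nonneg_laurent_poly_X_powi assms)
  then show ?thesis
    by (simp only: laurent_evalc_fps_inverse[OF assms(1) nonneg_laurent_poly_X_powi assms(2)] laurent_evalc_X_powi)
qed

lemma laurent_evalc_DT_coeff_integral:
  assumes "n < N" "0 < \<rho>" "\<rho> < 1" "norm z = 1"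
  shows "(LINT x:{-pi..pi}|lborel.
      (\<Prod>m=1..N. \<Prod>k<r * m. 1 / (1 - z powi weight r m k * (of_real \<rho> * cis x) ^ m)) * cis (- (real n * x)))
    = 2 * pi * laurent_evalc (DT_coeff n r) z * of_real \<rho> ^ n"
proof -
  define G where "G = (\<Prod>m=1..N. \<Prod>k<r * m. geom_fps (z powi weight r m k) m)"
  have z: "z \<noteq> 0" using assms by auto
  have nz: "norm (z powi i) \<le> 1" for i
    using assms by (simp add: norm_power_int)
  have rG: "fps_conv_radius (\<Prod>k<r * m. geom_fps (z powi weight r m k) m) \<ge> 1" for m
    by (intro fps_conv_radius_prod fps_conv_radius_geom_fps nz)
  have rG': "fps_conv_radius G \<ge> 1"
    unfolding G_def by (intro fps_conv_radius_prod rG)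
  have "eval_fps G w = (\<Prod>m=1..N. \<Prod>k<r * m. 1 / (1 - z powi weight r m k * w ^ m))"
    if "norm w < 1" for w
  proof -
    have w: "ereal (norm w) < 1"
      using that by (simp add: one_ereal_def)
    show ?thesis
      unfolding G_def eval_fps_prod[OF rG w] eval_fps_prod[OF fps_conv_radius_geom_fps[OF nz] w]
      using that by (intro prod.cong refl eval_fps_geom_fps nz) auto
  qed
  then have ev: "eval_fps G (of_real \<rho> * cis x) = (\<Prod>m=1..N. \<Prod>k<r * m. 1 / (1 - z powi weight r m k * (of_real \<rho> * cis x) ^ m))" for x
    using assms by (simp add: norm_mult)
  \<comment> \<open>The factors are indexed by \<open>Suc m\<close>, so levels 1 to \<open>N\<close>
    correspond to \<open>m \<le> N'\<close>. The partial product defining the coefficient reaches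
    level \<open>Suc n\<close>, hence the strict inequality \<open>n < N\<close>.\<close>
  obtain N' where N': "N = Suc N'" "n \<le> N'"
    using assms by (cases N) auto
  have "laurent_evalc (DT_coeff n r) z = fps_nth (laurent_evalc_fps (\<Prod>m\<le>N'. DT_factor r (Suc m)) z) n"
    using DT_partial_product_stable[OF N'(2), of r] by (simp add: laurent_evalc_fps_def DT_coeff_eq)
  also have "laurent_evalc_fps (\<Prod>m\<le>N'. DT_factor r (Suc m)) z = (\<Prod>m\<le>N'. laurent_evalc_fps (DT_factor r (Suc m)) z)"
    by (intro laurent_evalc_fps_prod nonneg_unit_fps_DT_factor z) simp
  also have "\<dots> = (\<Prod>m\<le>N'. \<Prod>k<r * Suc m. geom_fps (z powi weight r (Suc m) k) (Suc m))"
    by (intro prod.cong refl laurent_evalc_fps_DT_factor z) simp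
  also have "\<dots> = G"
    unfolding G_def N'(1) by (rule prod.reindex_bij_witness[of _ "\<lambda>m. m - 1" Suc]) auto
  finally show ?thesis
    using fps_nth_integral[OF rG' assms(2,3), of n] unfolding ev by simp
qed

text \<open>Characteristic function of the geometric law on the naturals with mean \<open>p\<close>.
  With the mean as parameter the cumulants are polynomials: p, p (1 + p), p (1 + p) (1 + 2
  p).\<close>

definition geom_cf :: "real \<Rightarrow> real \<Rightarrow> complex" where
  "geom_cf p y = 1 / (1 - of_real p * (cis y - 1))"

text \<open>Bose-Einstein occupation number: the mean of the geometric law with parameter e^(-tm).
  At \<open>m = 0\<close> division by zero gives 0, so sums over all \<open>m\<close> are
  harmless.\<close>

definition bose :: "real \<Rightarrow> nat \<Rightarrow> real" where
  "bose t m = 1 / (exp (t * real m) - 1)"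

lemma geometric_eq_geom_cf:
  assumes "t > 0" "m > 0"
  shows "1 / (1 - of_real (exp (- (t * real m))) * cis y) =
    geom_cf (bose t m) y / of_real (1 - exp (- (t * real m)))"
proof -
  define e where "e = exp (t * real m)"
  have e: "e > 1" using assms by (simp add: e_def)
  have *: "exp (- (t * real m)) = 1 / e" by (simp add: e_def exp_minus field_simps)
  have "(1 - 1 / (E - 1) * (c - 1)) * (1 - 1 / E) = 1 - 1 / E * c" if "E \<noteq> 0" "E \<noteq> 1" for E c :: complex
    using that by (simp add: field_simps)
  from this[of "of_real e" "cis y"]
  have "(1 - of_real (1 / (e - 1)) * (cis y - 1)) * of_real (1 - 1 / e) = 1 - of_real (1 / e) * cis y"
    using e by simp
  then show ?thesis
    unfolding geom_cf_def bose_def * e_def[symmetric] by simp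
qed

text \<open>Joint characteristic function, at (\<phi>, \<alpha>), of the size
  \<open>\<Sum> m X\<close> and the weight \<open>\<Sum> weight X\<close> of independent geometric
  variables on the levels up to \<open>N\<close>.\<close>

definition boltzmann :: "nat \<Rightarrow> nat \<Rightarrow> real \<Rightarrow> real \<Rightarrow> real \<Rightarrow> complex" where
  "boltzmann r N t \<phi> \<alpha> =
     (\<Prod>m=1..N. \<Prod>k<r * m. geom_cf (bose t m) (\<phi> * real m + \<alpha> * real_of_int (weight r m k)))"

lemma laurent_evalc_DT_coeff_boltzmann:
  assumes "n < N" "t > 0"
  shows "(LINT x:{-pi..pi}|lborel. boltzmann r N t x \<alpha> * cis (- (real n * x))) =
    2 * pi * of_real (exp (- t) ^ n * (\<Prod>m=1..N. \<Prod>k<r * m. 1 - exp (- (t * real m)))) *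
    laurent_evalc (DT_coeff n r) (cis \<alpha>)"
proof -
  define P where "P = (\<Prod>m=1..N. \<Prod>k<r * m. 1 - exp (- (t * real m)))"
  have "boltzmann r N t x \<alpha> = of_real P *
      (\<Prod>m=1..N. \<Prod>k<r * m. 1 / (1 - cis \<alpha> powi weight r m k * (of_real (exp (- t)) * cis x) ^ m))" for x
  proof -
    have "1 / (1 - cis \<alpha> powi weight r m k * (of_real (exp (- t)) * cis x) ^ m) * of_real (1 - exp (- (t * real m))) =
      geom_cf (bose t m) (x * real m + \<alpha> * real_of_int (weight r m k))" if "m \<in> {1..N}" for m k
    proof -
      have "cis \<alpha> powi weight r m k * (of_real (exp (- t)) * cis x) ^ m =
          of_real (exp (- (t * real m))) * cis (x * real m + \<alpha> * real_of_int (weight r m k))"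
      proof -
        have "exp (- t) ^ m = exp (- (t * real m))"
          by (simp add: mult.commute flip: exp_of_nat_mult)
        then have "of_real (exp (- t)) ^ m = (of_real (exp (- (t * real m))) :: complex)"
          by (simp flip: of_real_power)
        moreover have "cis \<alpha> powi weight r m k * cis x ^ m = cis (x * real m + \<alpha> * real_of_int (weight r m k))"
          by (simp add: Complex.DeMoivre cis_power_int cis_mult mult.commute add.commute)
        ultimately show ?thesis
          by (simp add: power_mult_distrib mult.left_commute)
      qed
      moreover have "exp (- (t * real m)) < 1"
        using assms that by simp
      ultimately show ?thesis
        using geometric_eq_geom_cf[of t m] assms that by simp
    qed
    then show ?thesis
      unfolding boltzmann_def P_def of_real_prod prod.distrib[symmetric]
      by (intro prod.cong refl) (simp add: mult.commute)
  qed
  then have "(LINT x:{-pi..pi}|lborel. boltzmann r N t x \<alpha> * cis (- (real n * x))) =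
      of_real P * (2 * pi * laurent_evalc (DT_coeff n r) (cis \<alpha>) * of_real (exp (- t)) ^ n)"
    using laurent_evalc_DT_coeff_integral[of n N "exp (- t)" "cis \<alpha>" r] assms
    by (simp add: mult.assoc)
  then show ?thesis
    by (simp add: P_def mult_ac)
qed

lemma laurent_evalc_at_1: "laurent_evalc f 1 = of_real (laurent_poly_eval f 1)"
  by (simp add: laurent_evalc_def laurent_poly_eval_def)

text \<open>The prefactor in Cauchy's formula depends on \<open>t\<close>, \<open>n\<close> and
  \<open>N\<close> but not on \<alpha>, so it cancels; \<alpha> = 0 gives evaluation at T = 1. Here
  \<open>t\<close> and \<open>N\<close> are still free and may be chosen for each
  \<open>n\<close>.\<close>

lemma laurent_evalc_DT_coeff_ratio:
  assumes "n < N" "t > 0"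
  shows "laurent_evalc (DT_coeff n r) (cis \<alpha>) / of_real (laurent_poly_eval (DT_coeff n r) 1) =
    (LINT x:{-pi..pi}|lborel. boltzmann r N t x \<alpha> * cis (- (real n * x))) /
    (LINT x:{-pi..pi}|lborel. boltzmann r N t x 0 * cis (- (real n * x)))"
proof -
  have "(\<Prod>m=1..N. \<Prod>k<r * m. 1 - exp (- (t * real m))) > 0"
    using assms by (intro prod_pos) auto
  then have "exp (- t) ^ n * (\<Prod>m=1..N. \<Prod>k<r * m. 1 - exp (- (t * real m))) > 0"
    by (intro mult_pos_pos zero_less_power) simp_all
  moreover define Q where "Q = exp (- t) ^ n * (\<Prod>m=1..N. \<Prod>k<r * m. 1 - exp (- (t * real m)))"
  ultimately have "Q > 0" by simp
  then show ?thesis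
    unfolding laurent_evalc_DT_coeff_boltzmann[OF assms] Q_def[symmetric] by (simp add: laurent_evalc_at_1)
qed

subsection \<open>The geometric characteristic function\<close>

lemma norm_geom_cf:
  assumes "p \<ge> 0"
  shows "norm (geom_cf p y) = 1 / sqrt (1 + 4 * p * (1 + p) * (sin (y / 2))\<^sup>2)"
proof -
  have "(norm (1 - of_real p * (cis y - 1)))\<^sup>2 = (1 + p - p * cos y)\<^sup>2 + (p * sin y)\<^sup>2"
    unfolding cmod_power2 by (simp add: algebra_simps)
  also have "\<dots> = (1 + p)\<^sup>2 - 2 * p * (1 + p) * cos y + p\<^sup>2 * ((sin y)\<^sup>2 + (cos y)\<^sup>2)"
  proof -
    have "(1 + p - p * a)\<^sup>2 + (p * b)\<^sup>2 = (1 + p)\<^sup>2 - 2 * p * (1 + p) * a + p\<^sup>2 * (b\<^sup>2 + a\<^sup>2)" for a b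
      by (simp add: power2_eq_square algebra_simps)
    then show ?thesis .
  qed
  also have "cos y = 1 - 2 * (sin (y / 2))\<^sup>2"
    using cos_double_sin[of "y / 2"] by simp
  also have "(1 + p)\<^sup>2 - 2 * p * (1 + p) * (1 - 2 * (sin (y / 2))\<^sup>2) + p\<^sup>2 * ((sin y)\<^sup>2 + (1 - 2 * (sin (y / 2))\<^sup>2)\<^sup>2)
      = 1 + 4 * p * (1 + p) * (sin (y / 2))\<^sup>2"
  proof -
    have "(sin y)\<^sup>2 + (1 - 2 * (sin (y / 2))\<^sup>2)\<^sup>2 = 1"
      using cos_double_sin[of "y / 2"] sin_cos_squared_add[of y] by simp
    then show ?thesis
      by (simp add: power2_eq_square algebra_simps)
  qed
  finally have "(norm (1 - of_real p * (cis y - 1)))\<^sup>2 = 1 + 4 * p * (1 + p) * (sin (y / 2))\<^sup>2" .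
  then have "norm (1 - of_real p * (cis y - 1)) = sqrt (1 + 4 * p * (1 + p) * (sin (y / 2))\<^sup>2)"
    by (metis norm_ge_zero real_sqrt_unique)
  then show ?thesis
    by (simp add: geom_cf_def norm_divide)
qed

lemma norm_geom_cf_le_1: "p \<ge> 0 \<Longrightarrow> norm (geom_cf p y) \<le> 1"
  using real_sqrt_ge_one[of "1 + 4 * p * (1 + p) * (sin (y / 2))\<^sup>2"]
  by (simp add: norm_geom_cf divide_le_eq_1_pos less_le_trans[OF zero_less_one])

text \<open>For such \<open>p\<close> the coefficient 4 p (1 + p) is at least 1, so with s the
  squared sine the squared norm is at most 1 / (1 + s), and 1 + s dominates e^(s/2) on
  [0, 1].\<close>

lemma norm_geom_cf_le_exp:
  assumes "p \<ge> 1 / 2"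
  shows "norm (geom_cf p y) \<le> exp (- ((sin (y / 2))\<^sup>2 / 4))"
proof -
  define s where "s = (sin (y / 2))\<^sup>2"
  have s: "0 \<le> s" "s \<le> 1"
    by (simp_all add: s_def abs_square_le_1)
  have "exp (s / 4) ^ 2 = exp (s / 2)"
    by (simp flip: exp_double)
  also have "\<dots> \<le> 1 + s / 2 + (s / 2)\<^sup>2"
    using s by (intro exp_bound) auto
  also have "\<dots> \<le> 1 + s"
    using s mult_left_mono[of s 1 s] by (simp add: power2_eq_square field_simps)
  also have "\<dots> \<le> 1 + 4 * p * (1 + p) * s"
  proof -
    have "1 * s \<le> (4 * p * (1 + p)) * s"
      using assms s mult_mono[of "1/2" p 1 "1 + p"] by (intro mult_right_mono) auto
    then show ?thesis by simp
  qed
  finally have "exp (s / 4) \<le> sqrt (1 + 4 * p * (1 + p) * s)"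
    by (rule real_le_rsqrt)
  then have "inverse (sqrt (1 + 4 * p * (1 + p) * s)) \<le> inverse (exp (s / 4))"
    by (intro le_imp_inverse_le) auto
  then show ?thesis
    using assms by (simp add: norm_geom_cf s_def exp_minus field_simps)
qed

text \<open>Taylor's formula for \<open>- Ln D\<close> along the real line. There
  \<open>Re (D z) \<ge> 1\<close>, which keeps the logarithm off its branch cut. The function
  \<open>h\<close> is a complex occupation number: it satisfies h' = i h (1 + h), so all derivatives
  are polynomials in \<open>h\<close>, with \<open>h 0 = p\<close> and
  \<open>norm (h z) \<le> p\<close> giving both the coefficients and the remainder bound.\<close>

lemma geom_cf_expansion:
  assumes "p \<ge> 0"
  obtains w where "geom_cf p y = exp (\<i> * of_real (p * y) - of_real (p * (1 + p) * y\<^sup>2 / 2) + w)"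
    "norm w \<le> p * (1 + p) * (1 + 2 * p) * \<bar>y\<bar> ^ 3"
proof -
  define D where "D z = 1 - of_real p * (exp (\<i> * z) - 1)" for z
  define h where "h z = of_real p * exp (\<i> * z) / D z" for z
  define f where "f n z = (if n = 0 then - Ln (D z) else if n = 1 then \<i> * h z
      else if n = 2 then - h z * (1 + h z) else - \<i> * h z * (1 + h z) * (1 + 2 * h z))"
    for n :: nat and z
  have D: "Re (D z) \<ge> 1" and h: "norm (h z) \<le> p" if "z \<in> \<real>" for z
  proof -
    have e: "norm (exp (\<i> * z)) = 1"
      using that by (auto elim!: Reals_cases)
    then have "p * Re (exp (\<i> * z)) \<le> p * 1"
      using assms complex_Re_le_cmod[of "exp (\<i> * z)"] by (intro mult_left_mono) auto
    then show "Re (D z) \<ge> 1"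
      by (simp add: D_def algebra_simps)
    then have "norm (D z) \<ge> 1"
      using complex_Re_le_cmod[of "D z"] by linarith
    then have "p / norm (D z) \<le> p / 1"
      using assms by (intro divide_left_mono) auto
    then show "norm (h z) \<le> p"
      using assms e by (simp add: h_def norm_mult norm_divide)
  qed
  have D0: "D z \<noteq> 0" and D1: "D z \<notin> \<real>\<^sub>\<le>\<^sub>0" if "z \<in> \<real>" for z
    using D[OF that] by (auto simp: complex_nonpos_Reals_iff)
  have dD: "(D has_field_derivative (- of_real p * (\<i> * exp (\<i> * z)))) (at z within \<real>)" for z
    unfolding D_def by (auto intro!: derivative_eq_intros)
  have dh: "(h has_field_derivative (\<i> * h z * (1 + h z))) (at z within \<real>)" if "z \<in> \<real>" for z
    unfolding h_def[abs_def] using D0[OF that]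
    by (auto intro!: derivative_eq_intros dD simp: field_simps power2_eq_square)
  have "norm (f 0 (of_real y) - (\<Sum>i\<le>2. f i 0 * (of_real y - 0) ^ i / fact i))
    \<le> (p * (1 + p) * (1 + 2 * p)) * norm (of_real y - 0 :: complex) ^ Suc 2 / fact 2"
  proof (rule complex_Taylor[of "\<real>" 2 f])
    show "(f i has_field_derivative f (Suc i) x) (at x within \<real>)" if x: "x \<in> \<real>" and i: "i \<le> 2" for i x
    proof -
      consider "i = 0" | "i = 1" | "i = 2" using i by linarith
      then show ?thesis
      proof cases
        case 1
        have "((\<lambda>z. - Ln (D z)) has_field_derivative (\<i> * h x)) (at x within \<real>)"
          using D0[OF x] D1[OF x]
          by (auto intro!: derivative_eq_intros dD simp: h_def field_simps)
        then show ?thesis by (simp add: 1 f_def[abs_def])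
      next
        case 2
        have "((\<lambda>z. \<i> * h z) has_field_derivative (- h x * (1 + h x))) (at x within \<real>)"
          by (auto intro!: derivative_eq_intros dh x simp: algebra_simps)
        then show ?thesis by (simp add: 2 f_def[abs_def])
      next
        case 3
        have "((\<lambda>z. - h z * (1 + h z)) has_field_derivative (- \<i> * h x * (1 + h x) * (1 + 2 * h x))) (at x within \<real>)"
          by (auto intro!: derivative_eq_intros dh x simp: algebra_simps)
        then show ?thesis by (simp add: 3 f_def[abs_def])
      qed
    qed
    show "norm (f (Suc 2) x) \<le> p * (1 + p) * (1 + 2 * p)" if "x \<in> \<real>" for x
    proof -
      have "norm (1 + h x) \<le> 1 + p" "norm (1 + 2 * h x) \<le> 1 + 2 * p"
        using h[OF that] norm_triangle_ineq[of 1 "h x"] norm_triangle_ineq[of 1 "2 * h x"]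
        by (auto simp: norm_mult)
      then show ?thesis
        unfolding f_def using assms h[OF that] by (auto simp: norm_mult intro!: mult_mono)
    qed
  qed (auto simp: convex_def scaleR_conv_of_real)
  moreover have "D 0 = 1" "h 0 = of_real p" by (simp_all add: D_def h_def)
  then have "(\<Sum>i\<le>2. f i 0 * (of_real y - 0) ^ i / fact i) =
      \<i> * of_real (p * y) - of_real (p * (1 + p) * y\<^sup>2 / 2)"
    by (simp add: f_def numeral_2_eq_2 field_simps)
  moreover define w where "w = f 0 (of_real y) - (\<i> * of_real (p * y) - of_real (p * (1 + p) * y\<^sup>2 / 2))"
  ultimately have "norm w \<le> p * (1 + p) * (1 + 2 * p) * \<bar>y\<bar> ^ Suc 2 / 2"
    by simp
  also have "\<dots> \<le> p * (1 + p) * (1 + 2 * p) * \<bar>y\<bar> ^ 3"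
  proof -
    have "0 \<le> p * (1 + p) * (1 + 2 * p) * \<bar>y\<bar> ^ 3"
      using assms by simp
    then show ?thesis by (simp only: numeral_3_eq_3 numeral_2_eq_2)
  qed
  finally have "norm w \<le> p * (1 + p) * (1 + 2 * p) * \<bar>y\<bar> ^ 3" .
  moreover have "geom_cf p y = exp (f 0 (of_real y))"
    using D0[of "of_real y"] by (simp add: f_def exp_minus geom_cf_def D_def cis_conv_exp inverse_eq_divide)
  then have "geom_cf p y = exp (\<i> * of_real (p * y) - of_real (p * (1 + p) * y\<^sup>2 / 2) + w)"
    by (simp add: w_def)
  ultimately show ?thesis using that by blast
qed

subsection \<open>Lower bounds for trigonometric sums\<close>

lemma sin_ge_half:
  assumes "0 \<le> x" "x \<le> pi / 2"
  shows "x / 2 \<le> sin x"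
proof -
  \<comment> \<open>The constant is 1 - 1/6, from the cubic Taylor remainder. At
    \<open>x = 1\<close> it gives sin 1 at least 5/6, which exceeds half of pi / 2; monotonicity
    then covers the rest of the range.\<close>
  have *: "x * (5 / 6) \<le> sin x" if "0 \<le> x" "x \<le> 1" for x :: real
  proof -
    have "\<bar>sin x - (\<Sum>m<3. sin_coeff m * x ^ m)\<bar> \<le> inverse (fact 3) * \<bar>x\<bar> ^ 3"
      by (rule Maclaurin_sin_bound)
    then have "\<bar>sin x - x\<bar> \<le> x ^ 3 / 6"
      using that by (simp add: numeral_3_eq_3 sin_coeff_def fact_numeral eval_nat_numeral)
    moreover have "x ^ 3 \<le> x"
      using that power_decreasing[of 1 3 x] by simp
    ultimately show ?thesis by linarith
  qed
  show ?thesis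
  proof (cases "x \<le> 1")
    case True
    then show ?thesis using *[of x] assms by linarith
  next
    case False
    then have "sin 1 \<le> sin x"
      using assms by (intro sin_monotone_2pi_le) auto
    moreover have "x \<le> 1.6"
      using assms pi_approx by simp
    ultimately show ?thesis using *[of 1] by simp
  qed
qed

lemma abs_sin_ge_half:
  assumes "\<bar>x\<bar> \<le> pi / 2"
  shows "\<bar>x\<bar> / 2 \<le> \<bar>sin x\<bar>"
  using sin_ge_half[of "\<bar>x\<bar>"] assms by (cases "x \<ge> 0") (auto simp: abs_if)

text \<open>Isolates the perturbation \<open>y\<close>: the addition formula gives |sin x| at most
  |sin (x + y)| + |y|, and (a + b)^2 is at most 2 a^2 + 2 b^2.\<close>

lemma sin_sq_add_ge:
  fixes x y :: real
  shows "(sin (x + y))\<^sup>2 \<ge> (sin x)\<^sup>2 / 2 - y\<^sup>2"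
proof -
  have "\<bar>sin x\<bar> = \<bar>sin (x + y) * cos y - cos (x + y) * sin y\<bar>"
    by (simp flip: sin_diff)
  also have "\<dots> \<le> \<bar>sin (x + y)\<bar> * \<bar>cos y\<bar> + \<bar>cos (x + y)\<bar> * \<bar>sin y\<bar>"
    by (metis abs_mult abs_triangle_ineq4)
  also have "\<dots> \<le> \<bar>sin (x + y)\<bar> * 1 + 1 * \<bar>y\<bar>"
    by (intro add_mono mult_mono) (auto simp: abs_sin_x_le_abs_x)
  finally have "\<bar>sin x\<bar>\<^sup>2 \<le> (\<bar>sin (x + y)\<bar> + \<bar>y\<bar>)\<^sup>2"
    by (intro power_mono) auto
  also have "\<dots> \<le> 2 * \<bar>sin (x + y)\<bar>\<^sup>2 + 2 * \<bar>y\<bar>\<^sup>2"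
    using zero_le_power2[of "\<bar>sin (x + y)\<bar> - \<bar>y\<bar>"] unfolding power2_sum power2_diff by linarith
  finally show ?thesis by simp
qed

lemma sum_cubes_ge: "real K ^ 4 / 4 \<le> (\<Sum>m=1..K. real m ^ 3)"
proof (induction K)
  case (Suc K)
  have "real (Suc K) ^ 4 / 4 \<le> real K ^ 4 / 4 + real (Suc K) ^ 3"
    by (simp add: power4_eq_xxxx power3_eq_cube algebra_simps)
  with Suc show ?case by simp
qed simp

text \<open>The Dirichlet kernel: after multiplication by 2 sin a each cosine is a difference of
  sines and the sum telescopes.\<close>

lemma sin_times_sum_cos:
  "A \<le> L \<Longrightarrow> 2 * sin a * (\<Sum>m=Suc A..L. cos (2 * a * real m)) =
    sin ((2 * real L + 1) * a) - sin ((2 * real A + 1) * a)" for a :: real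
proof (induction L rule: dec_induct)
  case (step L)
  have "2 * sin a * cos (2 * a * real (Suc L)) =
      sin ((2 * real (Suc L) + 1) * a) - sin ((2 * real L + 1) * a)"
  proof -
    have "2 * sin a * cos x = sin (x + a) - sin (x - a)" for x
      by (simp add: sin_add sin_diff)
    from this[of "2 * a * real (Suc L)"] show ?thesis
      by (simp add: algebra_simps)
  qed
  then show ?case using step by (simp add: algebra_simps)
qed simp

text \<open>For angles up to \<open>32 / L\<close> the terms with \<open>m \<le> L / 16\<close> have not wrapped around and suffice; for
  larger angles the cosines cancel.\<close>

lemma sum_sin_sq_ge:
  fixes \<phi> :: real
  assumes "L \<ge> 32" "\<bar>\<phi>\<bar> \<le> pi"
  shows "(\<Sum>m=1..L. real m * (sin (\<phi> * real m / 2))\<^sup>2) \<ge> min (\<phi>\<^sup>2 * real L ^ 4) (real L ^ 2) / 2 ^ 26"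
proof (cases "\<bar>\<phi>\<bar> * real L \<le> 32")
  case True
  \<comment> \<open>For \<open>m \<le> K\<close> the half angle \<phi> m / 2 is at most 1 in
    modulus, well below pi / 2, while \<open>L \<ge> 32\<close> keeps \<open>K\<close> at least L /
    32. The loss is 16 * 4 * 32^4 = 2^26.\<close>
  define K where "K = L div 16"
  have K: "16 * real K \<le> real L" "32 * real K \<ge> real L"
    using assms unfolding K_def by linarith+
  have "\<phi>\<^sup>2 * real L ^ 4 / 2 ^ 26 = \<phi>\<^sup>2 / 16 * ((real L / 32) ^ 4 / 4)"
    by (simp add: field_simps)
  also have "\<dots> \<le> \<phi>\<^sup>2 / 16 * (real K ^ 4 / 4)"
    using K by (intro mult_left_mono divide_right_mono power_mono) auto
  also have "\<dots> \<le> \<phi>\<^sup>2 / 16 * (\<Sum>m=1..K. real m ^ 3)"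
    by (intro mult_left_mono sum_cubes_ge) auto
  also have "\<dots> = (\<Sum>m=1..K. real m * (\<bar>\<phi> * real m / 2\<bar> / 2)\<^sup>2)"
    by (simp add: sum_distrib_left power_mult_distrib power_divide power3_eq_cube power2_eq_square mult_ac)
  also have "\<dots> \<le> (\<Sum>m=1..K. real m * \<bar>sin (\<phi> * real m / 2)\<bar>\<^sup>2)"
  proof (intro sum_mono mult_left_mono power_mono abs_sin_ge_half)
    fix m assume "m \<in> {1..K}"
    then have "\<bar>\<phi>\<bar> * real m \<le> \<bar>\<phi>\<bar> * (real L / 16)"
      using K by (intro mult_left_mono) auto
    then show "\<bar>\<phi> * real m / 2\<bar> \<le> pi / 2"
      using True pi_gt3 by (simp add: abs_mult)
  qed auto
  also have "\<dots> \<le> (\<Sum>m=1..L. real m * \<bar>sin (\<phi> * real m / 2)\<bar>\<^sup>2)"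
    using K by (intro sum_mono2) auto
  finally show ?thesis by auto
next
  case False
  \<comment> \<open>Restricting to the upper half makes the factor \<open>m\<close> at least L / 2.
    There are at least about L / 2 terms, whereas the kernel bounds their cosine sum
    \<open>C\<close> by 1 / |sin a|, which is at most L / 8.\<close>
  define A where "A = L div 2"
  define a where "a = \<phi> / 2"
  have "L \<le> 2 * (A + 1)"
    unfolding A_def by presburger
  then have "real L \<le> real (2 * (A + 1))"
    by (rule of_nat_mono)
  moreover have "A \<le> L" "2 * real A \<le> real L"
    unfolding A_def by linarith+
  ultimately have A: "A \<le> L" "2 * real A \<le> real L" "2 * (real A + 1) \<ge> real L"
    by simp_all
  have L: "real L > 0" using assms by simp
  have "\<bar>a\<bar> / 2 \<le> \<bar>sin a\<bar>"
    using assms by (intro abs_sin_ge_half) (simp add: a_def)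
  moreover have "8 / real L \<le> \<bar>a\<bar> / 2"
    using False L by (simp add: a_def field_simps)
  ultimately have sa: "8 / real L \<le> \<bar>sin a\<bar>" by linarith
  define C where "C = (\<Sum>m=Suc A..L. cos (2 * a * real m))"
  have "2 * \<bar>sin a\<bar> * \<bar>C\<bar> = \<bar>2 * sin a * C\<bar>"
    by (simp add: abs_mult)
  also have "\<dots> = \<bar>sin ((2 * real L + 1) * a) - sin ((2 * real A + 1) * a)\<bar>"
    by (simp only: sin_times_sum_cos[OF A(1)] C_def)
  also have "\<dots> \<le> 2"
    using abs_sin_le_one[of "(2 * real L + 1) * a"] abs_sin_le_one[of "(2 * real A + 1) * a"] by linarith
  finally have "8 / real L * \<bar>C\<bar> \<le> 1"
    using mult_right_mono[OF sa, of "\<bar>C\<bar>"] by linarith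
  then have C: "C \<le> real L / 8"
    using L by (simp add: field_simps)
  have "real L ^ 2 / 2 ^ 26 \<le> (real L / 2) * ((real L / 2 - real L / 8) / 2)"
    by (simp add: power2_eq_square)
  also have "\<dots> \<le> (real L / 2) * ((real (L - A) - C) / 2)"
    using C A by (intro mult_left_mono divide_right_mono) (auto simp: of_nat_diff)
  also have "real (L - A) - C = (\<Sum>m=Suc A..L. 1 - cos (2 * a * real m))"
    by (simp add: C_def sum_subtractf)
  also have "\<dots> = (\<Sum>m=Suc A..L. 2 * (sin (\<phi> * real m / 2))\<^sup>2)"
    using cos_double_sin[of "\<phi> * real _ / 2"] by (simp add: a_def)
  also have "(real L / 2) * (\<dots> / 2) = (\<Sum>m=Suc A..L. (real L / 2) * (sin (\<phi> * real m / 2))\<^sup>2)"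
    by (simp add: sum_distrib_left sum_divide_distrib)
  also have "\<dots> \<le> (\<Sum>m=Suc A..L. real m * (sin (\<phi> * real m / 2))\<^sup>2)"
    using A by (intro sum_mono mult_right_mono) auto
  also have "\<dots> \<le> (\<Sum>m=1..L. real m * (sin (\<phi> * real m / 2))\<^sup>2)"
    by (intro sum_mono2) auto
  finally show ?thesis by auto
qed

subsection \<open>Asymptotics of Bose sums\<close>

text \<open>Tonelli for double series: nonnegativity turns \<open>sums\<close> into unconditional
  summation over pairs, where the order is immaterial.\<close>

lemma sums_swap_nonneg:
  fixes f :: "nat \<Rightarrow> nat \<Rightarrow> real"
  assumes nonneg: "\<And>m j. f m j \<ge> 0"
    and g: "\<And>m. f m sums g m" and h: "\<And>j. (\<lambda>m. f m j) sums h j" and "summable h"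
  shows "g sums suminf h"
proof -
  have h0: "h j \<ge> 0" for j
    using sums_le[OF _ sums_zero h[of j]] nonneg by auto
  have hs: "((\<lambda>m. f m j) has_sum h j) UNIV" for j
    using h nonneg by (intro sums_nonneg_imp_has_sum)
  have H: "(h has_sum suminf h) UNIV"
    using \<open>summable h\<close> h0 by (intro sums_nonneg_imp_has_sum summable_sums)
  have "(\<lambda>(j, m). f m j) summable_on UNIV \<times> UNIV"
    by (rule summable_on_SigmaI[where g = h]) (use hs H nonneg in \<open>auto simp: summable_on_def\<close>)
  then have "((\<lambda>(j, m). f m j) has_sum suminf h) (UNIV \<times> UNIV)"
    using hs H by (intro has_sum_SigmaI[where g = h]) auto
  then have "((\<lambda>(m, j). f m j) has_sum suminf h) (UNIV \<times> UNIV)"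
    by (subst (asm) has_sum_swap) (simp add: case_prod_unfold)
  then have "(g has_sum suminf h) UNIV"
    by (rule has_sum_SigmaD) (use g nonneg in \<open>auto intro: sums_nonneg_imp_has_sum\<close>)
  then show ?thesis by (rule has_sum_imp_sums)
qed

text \<open>The polylogarithm of order -a at e^(-y).\<close>

definition power_exp_sum :: "nat \<Rightarrow> real \<Rightarrow> real" where
  "power_exp_sum a y = (\<Sum>m. real m ^ a * exp (- y) ^ m)"

lemma power_le_fact_exp:
  fixes z :: real
  assumes "z \<ge> 0"
  shows "z ^ a \<le> fact a * exp z"
proof -
  have "(\<lambda>n. z ^ n / fact n) sums exp z"
    using exp_converges[of z] by (simp add: divide_inverse mult.commute)
  then have "(\<Sum>n\<in>{a}. z ^ n / fact n) \<le> exp z"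
    using assms by (intro sum_le_suminf[of _ "{a}", THEN order_trans]) (auto simp: sums_iff)
  then show ?thesis by (simp add: field_simps)
qed

text \<open>Half of the exponential decay absorbs the polynomial factor, leaving a geometric
  series.\<close>

lemma power_exp_term_le:
  assumes "y > 0"
  shows "real m ^ a * exp (- y) ^ m \<le> fact a * (2 / y) ^ a * exp (- (y / 2)) ^ m"
proof -
  define z where "z = y / 2 * real m"
  have "real m ^ a = (2 / y) ^ a * z ^ a"
    using assms by (simp add: z_def flip: power_mult_distrib)
  also have "\<dots> \<le> (2 / y) ^ a * (fact a * exp z)"
    using assms by (intro mult_left_mono power_le_fact_exp) (auto simp: z_def)
  finally have "real m ^ a * exp (- y) ^ m \<le> (2 / y) ^ a * (fact a * exp z) * exp (- y) ^ m"
    by (intro mult_right_mono) auto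
  also have "exp z * exp (- y) ^ m = exp (- (y / 2)) ^ m"
    by (simp add: z_def flip: exp_of_nat_mult exp_add)
  then have "(2 / y) ^ a * (fact a * exp z) * exp (- y) ^ m = fact a * (2 / y) ^ a * exp (- (y / 2)) ^ m"
    by (simp add: mult.assoc mult.left_commute)
  finally show ?thesis .
qed

lemma sums_power_exp_sum:
  assumes "y > 0"
  shows "(\<lambda>m. real m ^ a * exp (- y) ^ m) sums power_exp_sum a y"
proof -
  have "summable (\<lambda>m. fact a * (2 / y) ^ a * exp (- (y / 2)) ^ m)"
    using assms by (intro summable_mult summable_geometric) auto
  then have "summable (\<lambda>m. real m ^ a * exp (- y) ^ m)"
    by (rule summable_comparison_test'[where N = 0]) (use power_exp_term_le[OF assms] in simp)
  then show ?thesis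
    unfolding power_exp_sum_def by (rule summable_sums)
qed

lemma power_exp_sum_nonneg: "y > 0 \<Longrightarrow> power_exp_sum a y \<ge> 0"
  using sums_le[OF _ sums_zero sums_power_exp_sum[of y a]] by auto

lemma power_exp_sum_le:
  assumes "y > 0" "a \<ge> 1"
  shows "power_exp_sum a y \<le> fact a * 2 ^ Suc a / y ^ Suc a"
proof -
  define q where "q = exp (- (y / 2))"
  have q: "0 < q" "q < 1" using assms by (auto simp: q_def)
  \<comment> \<open>Since \<open>a \<ge> 1\<close> the term at 0 vanishes. Dropping it gains a
    factor \<open>q\<close>: it is q / (1 - q), not 1 / (1 - q), that stays below 2 / y for large
    \<open>y\<close> as well.\<close>
  have "(\<lambda>m. real (Suc m) ^ a * exp (- y) ^ Suc m) sums power_exp_sum a y"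
    using sums_power_exp_sum[OF assms(1), of a] assms(2) by (subst sums_Suc_iff) (simp add: power_0_left)
  moreover have "(\<lambda>m. fact a * (2 / y) ^ a * q * q ^ m) sums (fact a * (2 / y) ^ a * q * (1 / (1 - q)))"
    using q by (intro sums_mult geometric_sums) auto
  moreover have "real (Suc m) ^ a * exp (- y) ^ Suc m \<le> fact a * (2 / y) ^ a * q * q ^ m" for m
    using power_exp_term_le[OF assms(1), of "Suc m" a] by (simp only: q_def power_Suc mult.assoc)
  ultimately have "power_exp_sum a y \<le> fact a * (2 / y) ^ a * q * (1 / (1 - q))"
    by (rule sums_le[rotated])
  also have "q * (1 / (1 - q)) \<le> 2 / y"
  proof -
    have "exp (y / 2) \<ge> 1 + y / 2" by (rule exp_ge_add_one_self)
    then have "(1 + y / 2) * q \<le> exp (y / 2) * q"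
      using q by (intro mult_right_mono) auto
    also have "\<dots> = 1" by (simp add: q_def flip: exp_add)
    finally show ?thesis
      using q assms by (simp add: field_simps)
  qed
  then have "fact a * (2 / y) ^ a * q * (1 / (1 - q)) \<le> fact a * (2 / y) ^ a * (2 / y)"
    using assms by (simp only: mult.assoc) (intro mult_left_mono, auto)
  also have "\<dots> = fact a * 2 ^ Suc a / y ^ Suc a"
    by (simp add: power_divide mult_ac)
  finally show ?thesis .
qed

text \<open>The operator x d/dx on power series; iterated on the geometric series it yields the
  closed forms for exponents 1, 2 and 3.\<close>

lemma sums_index_times:
  fixes c :: "nat \<Rightarrow> real"
  assumes "\<And>x. \<bar>x\<bar> < 1 \<Longrightarrow> (\<lambda>m. c m * x ^ m) sums f x" "\<bar>x\<bar> < 1" "(f has_real_derivative D) (at x)"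
  shows "(\<lambda>m. real m * c m * x ^ m) sums (x * D)"
proof -
  have "(\<lambda>n. diffs c n * x ^ n) sums D"
    using assms by (intro termdiffs_sums_strong[of 1 c f]) auto
  then have "(\<lambda>n. real n * c n * x ^ (n - Suc 0)) sums D"
    using diffs_equiv[of c x] by (auto simp: sums_iff)
  then have "(\<lambda>n. x * (real n * c n * x ^ (n - Suc 0))) sums (x * D)"
    by (rule sums_mult)
  moreover have "x * (real n * c n * x ^ (n - Suc 0)) = real n * c n * x ^ n" for n
    by (cases n) auto
  ultimately show ?thesis by simp
qed

lemma power_sums:
  fixes x :: real
  assumes "\<bar>x\<bar> < 1"
  shows "(\<lambda>m. real m ^ 1 * x ^ m) sums (x / (1 - x) ^ 2)"
    and "(\<lambda>m. real m ^ 2 * x ^ m) sums (x * (1 + x) / (1 - x) ^ 3)"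
    and "(\<lambda>m. real m ^ 3 * x ^ m) sums (x * (1 + 4 * x + x\<^sup>2) / (1 - x) ^ 4)"
proof -
  have 0: "(\<lambda>m. 1 * x ^ m) sums (1 / (1 - x))" if "\<bar>x\<bar> < 1" for x :: real
    using geometric_sums[of x] that by simp
  have 1: "(\<lambda>m. real m ^ 1 * x ^ m) sums (x / (1 - x) ^ 2)" if x: "\<bar>x\<bar> < 1" for x :: real
  proof -
    have "((\<lambda>x. 1 / (1 - x)) has_real_derivative (1 / (1 - x) ^ 2)) (at x)"
      using x by (auto intro!: derivative_eq_intros simp: power2_eq_square)
    from sums_index_times[OF 0 x this] show ?thesis by simp
  qed
  have 2: "(\<lambda>m. real m ^ 2 * x ^ m) sums (x * (1 + x) / (1 - x) ^ 3)" if x: "\<bar>x\<bar> < 1" for x :: real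
  proof -
    have "((\<lambda>x. x / (1 - x) ^ 2) has_real_derivative ((1 + x) / (1 - x) ^ 3)) (at x)"
      using x by (auto intro!: derivative_eq_intros simp: divide_simps) (simp add: eval_nat_numeral algebra_simps)
    from sums_index_times[OF 1 x this] show ?thesis by (simp add: power2_eq_square)
  qed
  show "(\<lambda>m. real m ^ 3 * x ^ m) sums (x * (1 + 4 * x + x\<^sup>2) / (1 - x) ^ 4)"
  proof -
    have "((\<lambda>x. x * (1 + x) / (1 - x) ^ 3) has_real_derivative ((1 + 4 * x + x\<^sup>2) / (1 - x) ^ 4)) (at x)"
      using assms by (auto intro!: derivative_eq_intros simp: divide_simps) (simp add: eval_nat_numeral algebra_simps)
    from sums_index_times[OF 2 assms this] show ?thesis by (simp add: power2_eq_square power3_eq_cube mult.assoc)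
  qed
  show "(\<lambda>m. real m ^ 1 * x ^ m) sums (x / (1 - x) ^ 2)" "(\<lambda>m. real m ^ 2 * x ^ m) sums (x * (1 + x) / (1 - x) ^ 3)"
    using 1 2 assms by auto
qed

lemma power_exp_sum_closed:
  assumes "y > 0"
  shows "power_exp_sum 1 y = exp (- y) / (1 - exp (- y)) ^ 2"
    and "power_exp_sum 2 y = exp (- y) * (1 + exp (- y)) / (1 - exp (- y)) ^ 3"
    and "power_exp_sum 3 y = exp (- y) * (1 + 4 * exp (- y) + (exp (- y))\<^sup>2) / (1 - exp (- y)) ^ 4"
  using power_sums[of "exp (- y)"] assms unfolding power_exp_sum_def by (auto simp: sums_iff)

lemma eventually_at_right_0: "eventually (\<lambda>y::real. y > 0) (at_right 0)"
  by (simp add: eventually_at_right_less)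

text \<open>The second limit goes beyond leading order: the exponent-2 sum gives the mean size,
  which must match \<open>n\<close> up to an error o(t^-2).\<close>

lemma power_exp_sum_limits:
  shows "((\<lambda>y. y ^ 2 * power_exp_sum 1 y) \<longlongrightarrow> 1) (at_right 0)"
    and "((\<lambda>y. y ^ 2 * (power_exp_sum 2 y - 2 / y ^ 3)) \<longlongrightarrow> 0) (at_right 0)"
    and "((\<lambda>y. y ^ 4 * power_exp_sum 3 y) \<longlongrightarrow> 6) (at_right 0)"
proof -
  have "((\<lambda>y::real. y ^ 2 * (exp (- y) / (1 - exp (- y)) ^ 2)) \<longlongrightarrow> 1) (at_right 0)"
    by real_asymp
  then show "((\<lambda>y. y ^ 2 * power_exp_sum 1 y) \<longlongrightarrow> 1) (at_right 0)"
    by (rule Lim_transform_eventually)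
      (rule eventually_mono[OF eventually_at_right_0], simp add: power_exp_sum_closed del: One_nat_def)
  have "((\<lambda>y::real. y ^ 2 * (exp (- y) * (1 + exp (- y)) / (1 - exp (- y)) ^ 3 - 2 / y ^ 3)) \<longlongrightarrow> 0) (at_right 0)"
    by real_asymp
  then show "((\<lambda>y. y ^ 2 * (power_exp_sum 2 y - 2 / y ^ 3)) \<longlongrightarrow> 0) (at_right 0)"
    by (rule Lim_transform_eventually)
      (rule eventually_mono[OF eventually_at_right_0], simp add: power_exp_sum_closed del: One_nat_def)
  have "((\<lambda>y::real. y ^ 4 * (exp (- y) * (1 + 4 * exp (- y) + (exp (- y))\<^sup>2) / (1 - exp (- y)) ^ 4)) \<longlongrightarrow> 6) (at_right 0)"
    by real_asymp
  then show "((\<lambda>y. y ^ 4 * power_exp_sum 3 y) \<longlongrightarrow> 6) (at_right 0)"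
    by (rule Lim_transform_eventually)
      (rule eventually_mono[OF eventually_at_right_0], simp add: power_exp_sum_closed del: One_nat_def)
qed

text \<open>The limit at 0 controls small \<open>y\<close> only. Tannery's theorem needs a bound for
  all positive \<open>y\<close>; away from 0 the two parts separately give 16 / y^3 + 2 /
  y^3.\<close>

lemma power_exp_sum_2_error_bounded:
  "\<exists>C. \<forall>y>0. \<bar>y ^ 2 * (power_exp_sum 2 y - 2 / y ^ 3)\<bar> \<le> C"
proof -
  have "eventually (\<lambda>y. \<bar>y ^ 2 * (power_exp_sum 2 y - 2 / y ^ 3)\<bar> < 1) (at_right 0)"
    using order_tendstoD(2)[OF tendsto_rabs[OF power_exp_sum_limits(2)], of 1] by simp
  then obtain d where d: "d > 0" "\<And>y. 0 < y \<Longrightarrow> y < d \<Longrightarrow> \<bar>y ^ 2 * (power_exp_sum 2 y - 2 / y ^ 3)\<bar> < 1"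
    unfolding eventually_at_right_field by auto
  have "\<bar>y ^ 2 * (power_exp_sum 2 y - 2 / y ^ 3)\<bar> \<le> 1 + 18 / d" if y: "y > 0" for y
  proof (cases "y < d")
    case True
    then have "\<bar>y ^ 2 * (power_exp_sum 2 y - 2 / y ^ 3)\<bar> \<le> 1"
      using d(2)[of y] y by simp
    also have "\<dots> \<le> 1 + 18 / d" using d by simp
    finally show ?thesis .
  next
    case False
    have "0 \<le> power_exp_sum 2 y" "power_exp_sum 2 y \<le> 16 / y ^ 3"
      using power_exp_sum_nonneg[OF y] power_exp_sum_le[OF y, of 2] by (auto simp: fact_numeral eval_nat_numeral)
    moreover have "2 / y ^ 3 \<ge> 0" using y by simp
    ultimately have "\<bar>power_exp_sum 2 y - 2 / y ^ 3\<bar> \<le> 16 / y ^ 3 + 2 / y ^ 3"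
      by linarith
    also have "\<dots> = 18 / y ^ 3" by (simp add: add_divide_distrib[symmetric])
    finally have "\<bar>y ^ 2 * (power_exp_sum 2 y - 2 / y ^ 3)\<bar> \<le> y ^ 2 * (18 / y ^ 3)"
      unfolding abs_mult by (intro mult_mono) auto
    also have "\<dots> = 18 / y"
      using y by (simp add: power2_eq_square power3_eq_cube)
    also have "\<dots> \<le> 18 / d"
      using False d y by (intro divide_left_mono) auto
    finally show ?thesis by simp
  qed
  then show ?thesis by blast
qed

lemma summable_inverse_Suc_power: "k \<ge> 2 \<Longrightarrow> summable (\<lambda>j. 1 / real (Suc j) ^ k)"
  using inverse_power_summable[of k, where ?'a = real] summable_Suc_iff[of "\<lambda>n. inverse (real n ^ k)"]
  by (simp only: inverse_eq_divide)

text \<open>Each argument t (j + 1) tends to 0 for fixed \<open>j\<close>, but for fixed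
  \<open>t\<close> the arguments are unbounded; hence \<open>\<phi>\<close> has to be bounded on the
  whole half-line, and \<open>k \<ge> 2\<close> makes the majorant summable.\<close>

lemma tendsto_dilated_sum:
  fixes \<phi> :: "real \<Rightarrow> real"
  assumes lim: "(\<phi> \<longlongrightarrow> l) (at_right 0)" and bd: "\<And>y. y > 0 \<Longrightarrow> \<bar>\<phi> y\<bar> \<le> C" and k: "k \<ge> 2"
  shows "((\<lambda>t. \<Sum>j. \<phi> (t * real (Suc j)) / real (Suc j) ^ k) \<longlongrightarrow> l * (\<Sum>j. 1 / real (Suc j) ^ k)) (at_right 0)"
proof -
  have "((\<lambda>t. \<Sum>j. \<phi> (t * real (Suc j)) / real (Suc j) ^ k) \<longlongrightarrow> (\<Sum>j. l / real (Suc j) ^ k)) (at_right 0)"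
  proof (rule tannerys_theorem[THEN conjunct2, THEN conjunct2])
    show "((\<lambda>t. \<phi> (t * real (Suc j)) / real (Suc j) ^ k) \<longlongrightarrow> l / real (Suc j) ^ k) (at_right 0)" for j
    proof (intro tendsto_divide tendsto_const)
      have "filterlim (\<lambda>t. t * real (Suc j)) (at_right 0) (at_right 0)"
        by real_asymp
      then show "((\<lambda>t. \<phi> (t * real (Suc j))) \<longlongrightarrow> l) (at_right 0)"
        by (rule filterlim_compose[OF lim])
    qed simp
    show "\<forall>\<^sub>F (j, t) in sequentially \<times>\<^sub>F at_right 0. norm (\<phi> (t * real (Suc j)) / real (Suc j) ^ k) \<le> C / real (Suc j) ^ k"
    proof -
      have "eventually (\<lambda>p::nat \<times> real. snd p > 0) (sequentially \<times>\<^sub>F at_right 0)"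
        by (rule eventually_compose_filterlim[OF eventually_at_right_0 filterlim_snd])
      then show ?thesis
      proof eventually_elim
        case (elim p)
        then show ?case
          using bd[of "snd p * real (Suc (fst p))"]
          by (auto simp: case_prod_unfold abs_mult abs_divide simp del: of_nat_Suc intro!: divide_right_mono)
      qed
    qed
    show "summable (\<lambda>j. C / real (Suc j) ^ k)"
      using summable_mult[OF summable_inverse_Suc_power[OF k], of C] by simp
  qed simp
  also have "(\<Sum>j. l / real (Suc j) ^ k) = l * (\<Sum>j. 1 / real (Suc j) ^ k)"
    using suminf_mult[OF summable_inverse_Suc_power[OF k], of l] by simp
  finally show ?thesis .
qed

section \<open>Mean and variance sums of the occupation numbers\<close>

lemma bose_nonneg: "t > 0 \<Longrightarrow> bose t m \<ge> 0"
  by (simp add: bose_def)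

lemma sums_bose:
  assumes t: "t > 0" and a: "a \<ge> 1"
  shows "summable (\<lambda>j. power_exp_sum a (t * real (Suc j)))"
    and "(\<lambda>m. real m ^ a * bose t m) sums (\<Sum>j. power_exp_sum a (t * real (Suc j)))"
proof -
  show sm: "summable (\<lambda>j. power_exp_sum a (t * real (Suc j)))"
  proof (rule summable_comparison_test'[where N = 0])
    show "summable (\<lambda>j. fact a * 2 ^ Suc a / t ^ Suc a * (1 / real (Suc j) ^ Suc a))"
      using a by (intro summable_mult summable_inverse_Suc_power) auto
    show "norm (power_exp_sum a (t * real (Suc j))) \<le> fact a * 2 ^ Suc a / t ^ Suc a * (1 / real (Suc j) ^ Suc a)" for j
      using power_exp_sum_le[of "t * real (Suc j)" a] power_exp_sum_nonneg[of "t * real (Suc j)" a] a t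
      by (simp add: power_mult_distrib mult_ac del: of_nat_Suc)
  qed
  show "(\<lambda>m. real m ^ a * bose t m) sums (\<Sum>j. power_exp_sum a (t * real (Suc j)))"
  proof (rule sums_swap_nonneg[OF _ _ _ sm])
    show "(\<lambda>j. real m ^ a * exp (- (t * real (Suc j))) ^ m) sums (real m ^ a * bose t m)" for m
    proof (cases "m = 0")
      case False
      define x where "x = exp (- (t * real m))"
      have x: "0 < x" "x < 1" using t False by (auto simp: x_def)
      have "(\<lambda>j. real m ^ a * (x * x ^ j)) sums (real m ^ a * (x * (1 / (1 - x))))"
        using x by (intro sums_mult geometric_sums) auto
      moreover have "x * x ^ j = exp (- (t * real (Suc j))) ^ m" for j
        by (simp add: x_def algebra_simps flip: exp_of_nat_mult exp_add)
      moreover have "x * (1 / (1 - x)) = bose t m"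
        using x unfolding bose_def x_def by (simp add: exp_minus field_simps)
      ultimately show ?thesis by (simp only:)
    qed (use a in \<open>simp add: power_0_left\<close>)
    show "(\<lambda>m. real m ^ a * exp (- (t * real (Suc j))) ^ m) sums power_exp_sum a (t * real (Suc j))" for j
      using t by (intro sums_power_exp_sum) auto
  qed simp
qed

text \<open>The variance p (1 + p) equals x / (1 - x)^2 with x = e^(-tm), so its expansion carries
  an extra factor \<open>Suc j\<close>. This lowers the exponent of the outer series to
  \<open>a\<close> and forces \<open>a \<ge> 2\<close>.\<close>

lemma sums_bose_var:
  assumes t: "t > 0" and a: "a \<ge> 2"
  shows "summable (\<lambda>j. real (Suc j) * power_exp_sum a (t * real (Suc j)))"
    and "(\<lambda>m. real m ^ a * (bose t m * (1 + bose t m))) sums (\<Sum>j. real (Suc j) * power_exp_sum a (t * real (Suc j)))"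
    and "(\<Sum>j. real (Suc j) * power_exp_sum a (t * real (Suc j))) \<le>
      fact a * 2 ^ Suc a * (\<Sum>j. 1 / real (Suc j) ^ a) / t ^ Suc a"
proof -
  have sb: "summable (\<lambda>j. fact a * 2 ^ Suc a / t ^ Suc a * (1 / real (Suc j) ^ a))"
    using a by (intro summable_mult summable_inverse_Suc_power) auto
  have le: "real (Suc j) * power_exp_sum a (t * real (Suc j)) \<le> fact a * 2 ^ Suc a / t ^ Suc a * (1 / real (Suc j) ^ a)" for j
  proof -
    have "real (Suc j) * power_exp_sum a (t * real (Suc j)) \<le> real (Suc j) * (fact a * 2 ^ Suc a / (t * real (Suc j)) ^ Suc a)"
      using a t by (intro mult_left_mono power_exp_sum_le) auto
    then show ?thesis
      by (simp add: power_mult_distrib mult_ac del: of_nat_Suc)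
  qed
  show sm: "summable (\<lambda>j. real (Suc j) * power_exp_sum a (t * real (Suc j)))"
    using le power_exp_sum_nonneg[of "t * real (Suc _)" a] t
    by (intro summable_comparison_test'[where N = 0, OF sb]) (auto simp del: of_nat_Suc)
  show "(\<Sum>j. real (Suc j) * power_exp_sum a (t * real (Suc j))) \<le>
      fact a * 2 ^ Suc a * (\<Sum>j. 1 / real (Suc j) ^ a) / t ^ Suc a"
    using suminf_le[OF le sm sb] suminf_mult[OF summable_inverse_Suc_power[OF a], of "fact a * 2 ^ Suc a / t ^ Suc a"]
    by (simp del: of_nat_Suc)
  show "(\<lambda>m. real m ^ a * (bose t m * (1 + bose t m))) sums (\<Sum>j. real (Suc j) * power_exp_sum a (t * real (Suc j)))"
  proof (rule sums_swap_nonneg[OF _ _ _ sm])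
    show "(\<lambda>j. real (Suc j) * (real m ^ a * exp (- (t * real (Suc j))) ^ m)) sums (real m ^ a * (bose t m * (1 + bose t m)))" for m
    proof (cases "m = 0")
      case False
      define x where "x = exp (- (t * real m))"
      have x: "0 < x" "x < 1" using t False by (auto simp: x_def)
      have "(\<lambda>j. real m ^ a * x * (real (Suc j) * x ^ j)) sums (real m ^ a * x * (1 / (1 - x)\<^sup>2))"
        using x by (intro sums_mult geometric_deriv_sums) auto
      moreover have "x * x ^ j = exp (- (t * real (Suc j))) ^ m" for j
        by (simp add: x_def algebra_simps flip: exp_of_nat_mult exp_add)
      then have "real m ^ a * x * (real (Suc j) * x ^ j) = real (Suc j) * (real m ^ a * exp (- (t * real (Suc j))) ^ m)" for j
        by (metis (no_types, opaque_lifting) mult.assoc mult.commute)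
      moreover have "bose t m = x / (1 - x)"
        using x unfolding bose_def x_def by (simp add: exp_minus field_simps)
      then have "x * (1 / (1 - x)\<^sup>2) = bose t m * (1 + bose t m)"
        using x by (simp only:) (simp add: field_simps power2_eq_square)
      ultimately show ?thesis by (simp only: mult.assoc)
    qed (use a in \<open>simp add: power_0_left\<close>)
    show "(\<lambda>m. real (Suc j) * (real m ^ a * exp (- (t * real (Suc j))) ^ m)) sums (real (Suc j) * power_exp_sum a (t * real (Suc j)))" for j
      using t by (intro sums_mult sums_power_exp_sum) auto
  qed simp
qed

lemma zeta_3_eq: "zeta 3 = (\<Sum>j. 1 / real (Suc j) ^ 3)"
  unfolding zeta_def by (intro suminf_cong) (simp add: powr_numeral)

lemma zeta_3_pos: "zeta 3 > 0"
  unfolding zeta_3_eq by (intro suminf_pos summable_inverse_Suc_power) auto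

lemma tendsto_bose_sums:
  shows "((\<lambda>t. t ^ 2 * (\<Sum>m. real m ^ 1 * bose t m)) \<longlongrightarrow> pi\<^sup>2 / 6) (at_right 0)"
    and "((\<lambda>t. t ^ 2 * ((\<Sum>m. real m ^ 2 * bose t m) - 2 * zeta 3 / t ^ 3)) \<longlongrightarrow> 0) (at_right 0)"
    and "((\<lambda>t. t ^ 4 * (\<Sum>m. real m ^ 3 * (bose t m * (1 + bose t m)))) \<longlongrightarrow> 6 * zeta 3) (at_right 0)"
proof -
  have ps: "\<bar>y ^ Suc a * power_exp_sum a y\<bar> \<le> fact a * 2 ^ Suc a" if "y > 0" "a \<ge> 1" for y a
    using power_exp_sum_le[OF that] power_exp_sum_nonneg[OF that(1), of a] that
    by (simp add: abs_mult field_simps)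
  have z2: "(\<Sum>j. 1 / real (Suc j) ^ 2) = pi\<^sup>2 / 6"
    using inverse_squares_sums by (simp add: sums_iff add.commute)
  have "((\<lambda>t. \<Sum>j. ((t * real (Suc j)) ^ 2 * power_exp_sum 1 (t * real (Suc j))) / real (Suc j) ^ 2)
      \<longlongrightarrow> 1 * (\<Sum>j. 1 / real (Suc j) ^ 2)) (at_right 0)"
    using ps[of _ 1] by (intro tendsto_dilated_sum power_exp_sum_limits(1)) (auto simp: numeral_2_eq_2)
  then show "((\<lambda>t. t ^ 2 * (\<Sum>m. real m ^ 1 * bose t m)) \<longlongrightarrow> pi\<^sup>2 / 6) (at_right 0)"
    unfolding z2 mult_1
  proof (rule Lim_transform_eventually, intro eventually_mono[OF eventually_at_right_0])
    fix t :: real assume t: "t > 0"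
    have "(\<Sum>j. ((t * real (Suc j)) ^ 2 * power_exp_sum 1 (t * real (Suc j))) / real (Suc j) ^ 2) =
        (\<Sum>j. t ^ 2 * power_exp_sum 1 (t * real (Suc j)))"
      by (intro suminf_cong) (simp add: power_mult_distrib del: of_nat_Suc)
    also have "\<dots> = t ^ 2 * (\<Sum>m. real m ^ 1 * bose t m)"
      using sums_bose[OF t, of 1] by (simp add: suminf_mult sums_iff del: power_one_right)
    finally show "(\<Sum>j. ((t * real (Suc j)) ^ 2 * power_exp_sum 1 (t * real (Suc j))) / real (Suc j) ^ 2) =
      t ^ 2 * (\<Sum>m. real m ^ 1 * bose t m)" .
  qed
  obtain C where C: "\<And>y. y > 0 \<Longrightarrow> \<bar>y ^ 2 * (power_exp_sum 2 y - 2 / y ^ 3)\<bar> \<le> C"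
    using power_exp_sum_2_error_bounded by blast
  \<comment> \<open>The singular part 2 / y^3 is removed before passing to the limit; over all
    \<open>j\<close> the removed parts add up to exactly 2 \<zeta>(3) / t^3.\<close>
  have "((\<lambda>t. \<Sum>j. ((t * real (Suc j)) ^ 2 * (power_exp_sum 2 (t * real (Suc j)) - 2 / (t * real (Suc j)) ^ 3)) / real (Suc j) ^ 2)
      \<longlongrightarrow> 0 * (\<Sum>j. 1 / real (Suc j) ^ 2)) (at_right 0)"
    using C by (intro tendsto_dilated_sum power_exp_sum_limits(2)) auto
  then show "((\<lambda>t. t ^ 2 * ((\<Sum>m. real m ^ 2 * bose t m) - 2 * zeta 3 / t ^ 3)) \<longlongrightarrow> 0) (at_right 0)"
    unfolding mult_zero_left
  proof (rule Lim_transform_eventually, intro eventually_mono[OF eventually_at_right_0])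
    fix t :: real assume t: "t > 0"
    have s3: "summable (\<lambda>j. 2 / t ^ 3 * (1 / real (Suc j) ^ 3))"
      by (intro summable_mult summable_inverse_Suc_power) auto
    have "(\<Sum>j. ((t * real (Suc j)) ^ 2 * (power_exp_sum 2 (t * real (Suc j)) - 2 / (t * real (Suc j)) ^ 3)) / real (Suc j) ^ 2) =
        (\<Sum>j. t ^ 2 * (power_exp_sum 2 (t * real (Suc j)) - 2 / t ^ 3 * (1 / real (Suc j) ^ 3)))"
      by (intro suminf_cong) (simp add: power_mult_distrib del: of_nat_Suc)
    also have "\<dots> = t ^ 2 * (\<Sum>j. power_exp_sum 2 (t * real (Suc j)) - 2 / t ^ 3 * (1 / real (Suc j) ^ 3))"
      using sums_bose(1)[OF t, of 2] s3 by (intro suminf_mult summable_diff) auto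
    also have "(\<Sum>j. power_exp_sum 2 (t * real (Suc j)) - 2 / t ^ 3 * (1 / real (Suc j) ^ 3)) =
        (\<Sum>m. real m ^ 2 * bose t m) - (\<Sum>j. 2 / t ^ 3 * (1 / real (Suc j) ^ 3))"
      using sums_bose[OF t, of 2] s3 by (subst suminf_diff[symmetric]) (auto simp: sums_iff)
    also have "(\<Sum>j. 2 / t ^ 3 * (1 / real (Suc j) ^ 3)) = 2 * zeta 3 / t ^ 3"
      unfolding zeta_3_eq by (subst suminf_mult[OF summable_inverse_Suc_power]) simp_all
    finally show "(\<Sum>j. ((t * real (Suc j)) ^ 2 * (power_exp_sum 2 (t * real (Suc j)) - 2 / (t * real (Suc j)) ^ 3)) / real (Suc j) ^ 2) =
        t ^ 2 * ((\<Sum>m. real m ^ 2 * bose t m) - 2 * zeta 3 / t ^ 3)" .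
  qed
  have "((\<lambda>t. \<Sum>j. ((t * real (Suc j)) ^ 4 * power_exp_sum 3 (t * real (Suc j))) / real (Suc j) ^ 3)
      \<longlongrightarrow> 6 * (\<Sum>j. 1 / real (Suc j) ^ 3)) (at_right 0)"
    using ps[of _ 3] by (intro tendsto_dilated_sum power_exp_sum_limits(3)) (auto simp: eval_nat_numeral)
  then show "((\<lambda>t. t ^ 4 * (\<Sum>m. real m ^ 3 * (bose t m * (1 + bose t m)))) \<longlongrightarrow> 6 * zeta 3) (at_right 0)"
    unfolding zeta_3_eq
  proof (rule Lim_transform_eventually, intro eventually_mono[OF eventually_at_right_0])
    fix t :: real assume t: "t > 0"
    have "(\<Sum>j. ((t * real (Suc j)) ^ 4 * power_exp_sum 3 (t * real (Suc j))) / real (Suc j) ^ 3) =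
        (\<Sum>j. t ^ 4 * (real (Suc j) * power_exp_sum 3 (t * real (Suc j))))"
      by (intro suminf_cong) (simp add: eval_nat_numeral del: of_nat_Suc)
    also have "\<dots> = t ^ 4 * (\<Sum>m. real m ^ 3 * (bose t m * (1 + bose t m)))"
      using sums_bose_var[OF t, of 3] by (simp add: suminf_mult sums_iff del: of_nat_Suc)
    finally show "(\<Sum>j. ((t * real (Suc j)) ^ 4 * power_exp_sum 3 (t * real (Suc j))) / real (Suc j) ^ 3) =
      t ^ 4 * (\<Sum>m. real m ^ 3 * (bose t m * (1 + bose t m)))" .
  qed
qed

subsection \<open>Domination and expansion of the integrand\<close>

lemma sum_arith_progression:
  fixes c :: real
  shows "(\<Sum>k<n. c + 2 * real k) = real n * c + real n * (real n - 1)"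
    and "(\<Sum>k<n. (c + 2 * real k)\<^sup>2) = real n * c\<^sup>2 + 2 * c * real n * (real n - 1)
      + 2 / 3 * (real n - 1) * real n * (2 * real n - 1)"
  by (induction n) (simp_all add: field_simps power2_eq_square)

text \<open>The weights run from 4 - rm to rm + 2 in steps of 2, so their average is 3. This average
  produces \<mu>; the cubic term of the second moment produces the limiting variance.\<close>

lemma sum_weight:
  "(\<Sum>k<r * m. real_of_int (weight r m k)) = 3 * (real r * real m)"
  "(\<Sum>k<r * m. (real_of_int (weight r m k))\<^sup>2) = (real r * real m) ^ 3 / 3 + 26 / 3 * (real r * real m)"
proof -
  have w: "real_of_int (weight r m k) = (4 - real r * real m) + 2 * real k" for k
    by (simp add: weight_def)
  show "(\<Sum>k<r * m. real_of_int (weight r m k)) = 3 * (real r * real m)"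
    unfolding w sum_arith_progression(1) by (simp add: algebra_simps)
  show "(\<Sum>k<r * m. (real_of_int (weight r m k))\<^sup>2) = (real r * real m) ^ 3 / 3 + 26 / 3 * (real r * real m)"
    unfolding w sum_arith_progression(2) by (simp add: field_simps power2_eq_square power3_eq_cube)
qed

lemma abs_weight_le:
  assumes "m \<ge> 1" "k < r * m"
  shows "\<bar>real_of_int (weight r m k)\<bar> \<le> (real r + 4) * real m"
proof -
  have "real k < real r * real m"
    using assms(2) by (simp flip: of_nat_mult)
  moreover have "real r * real m \<ge> 0" "real m \<ge> 1" using assms by auto
  ultimately show ?thesis
    by (simp add: weight_def abs_le_iff algebra_simps)
qed

lemma bose_le:
  assumes "t > 0" "m \<ge> 1"
  shows "bose t m \<le> 1 / (t * real m)"
proof -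
  have "0 < t * real m" "t * real m \<le> exp (t * real m) - 1"
    using assms exp_ge_add_one_self[of "t * real m"] by (simp, linarith)
  then show ?thesis
    unfolding bose_def by (intro divide_left_mono) auto
qed

section \<open>Exponential domination on the whole circle\<close>

lemma bose_ge_half:
  assumes "t > 0" "m \<ge> 1" "t * real m \<le> 1"
  shows "bose t m \<ge> 1 / 2"
proof -
  have "exp (t * real m) \<le> exp 1" using assms by simp
  also have "\<dots> \<le> 3" by (rule exp_le)
  finally have "exp (t * real m) - 1 \<le> 2" by simp
  moreover have "exp (t * real m) > 1" using assms by simp
  ultimately show ?thesis
    unfolding bose_def by (intro divide_left_mono) auto
qed

lemma norm_boltzmann_le_exp_sum:
  assumes "t > 0" "t * real L \<le> 1" "L \<le> N"
  shows "norm (boltzmann r N t \<phi> \<alpha>) \<le>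
    exp (- (\<Sum>m=1..L. \<Sum>k<r * m. (sin ((\<phi> * real m + \<alpha> * real_of_int (weight r m k)) / 2))\<^sup>2 / 4))"
proof -
  define s where "s m k = (sin ((\<phi> * real m + \<alpha> * real_of_int (weight r m k)) / 2))\<^sup>2 / 4" for m k
  \<comment> \<open>Levels above \<open>L\<close> are bounded trivially by 1, so their exponent is
    set to 0.\<close>
  define w where "w m k = (if m \<le> L then s m k else 0)" for m k
  have s0: "s m k \<ge> 0" for m k by (simp add: s_def)
  have "norm (boltzmann r N t \<phi> \<alpha>) =
      (\<Prod>m=1..N. \<Prod>k<r * m. norm (geom_cf (bose t m) (\<phi> * real m + \<alpha> * real_of_int (weight r m k))))"
    by (simp add: boltzmann_def prod_norm)
  also have "\<dots> \<le> (\<Prod>m=1..N. \<Prod>k<r * m. exp (- w m k))"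
  proof (intro prod_mono conjI prod_nonneg norm_ge_zero)
    fix m k assume m: "m \<in> {1..N}"
    show "norm (geom_cf (bose t m) (\<phi> * real m + \<alpha> * real_of_int (weight r m k))) \<le> exp (- w m k)"
    proof (cases "m \<le> L")
      case True
      then have "t * real m \<le> t * real L" using assms by (intro mult_left_mono) auto
      then have "t * real m \<le> 1" using assms by linarith
      then have "bose t m \<ge> 1 / 2"
        using assms m by (intro bose_ge_half) auto
      from norm_geom_cf_le_exp[OF this] True show ?thesis
        by (simp add: w_def s_def)
    next
      case False
      then show ?thesis
        using norm_geom_cf_le_1[OF bose_nonneg[OF assms(1)]] by (simp add: w_def)
    qed
  qed
  also have "\<dots> = exp (- (\<Sum>m=1..N. \<Sum>k<r * m. w m k))"
    by (simp add: exp_sum sum_negf[symmetric])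
  also have "\<dots> \<le> exp (- (\<Sum>m=1..L. \<Sum>k<r * m. w m k))"
    using assms s0 by (simp, intro sum_mono2) (auto simp: w_def intro!: sum_nonneg)
  also have "(\<Sum>m=1..L. \<Sum>k<r * m. w m k) = (\<Sum>m=1..L. \<Sum>k<r * m. s m k)"
    by (intro sum.cong) (auto simp: w_def)
  finally show ?thesis by (simp add: s_def)
qed

lemma norm_boltzmann_le:
  assumes r: "r \<ge> 1" and t: "0 < t" "t \<le> 1 / 64" and N: "real N \<ge> 1 / t" and u: "\<bar>u\<bar> \<le> pi / t\<^sup>2"
  shows "norm (boltzmann r N t (t\<^sup>2 * u) (b * t\<^sup>2)) \<le>
    exp (real r * b\<^sup>2 * (real r + 4)\<^sup>2 / 16 + 1 - \<bar>u\<bar> / 2 ^ 33)"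
proof -
  define L where "L = nat \<lfloor>1 / t\<rfloor>"
  have "64 \<le> 1 / t" using t by (simp add: field_simps)
  then have L: "real L \<le> 1 / t" "1 / (2 * t) \<le> real L" "32 \<le> L"
    unfolding L_def by (linarith | simp)+
  have LN: "L \<le> N" using L N by linarith
  have tL: "t * real L \<le> 1" using L t by (simp add: field_simps)
  define \<phi> where "\<phi> = t\<^sup>2 * u"
  define \<alpha> where "\<alpha> = b * t\<^sup>2"
  define G where "G = (\<Sum>m=1..L. real m * (sin (\<phi> * real m / 2))\<^sup>2)"
  have \<phi>: "\<bar>\<phi>\<bar> \<le> pi"
    using u t by (simp add: \<phi>_def abs_mult field_simps)
  \<comment> \<open>Of the two bounds in \<open>sum_sin_sq_ge\<close> one is of order u^2, the other
    of order t^-2, which is at least a multiple of |u| since |u| is at most pi / t^2. A linear bound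
    therefore holds throughout; the \<open>- 1\<close> comes from replacing u^2 by |u| - 1, and 2^30
    is 16 * 2^26.\<close>
  have G: "G \<ge> (\<bar>u\<bar> - 1) / 2 ^ 30"
  proof -
    have "(\<bar>u\<bar> - 1) / 16 \<le> \<phi>\<^sup>2 * real L ^ 4"
    proof -
      have "\<bar>u\<bar> - 1 \<le> \<bar>u\<bar>\<^sup>2"
        using zero_le_power2[of "\<bar>u\<bar> - 1"] unfolding power2_diff by (simp; linarith)
      then have "(\<bar>u\<bar> - 1) / 16 \<le> u\<^sup>2 / 16" by simp
      also have "\<dots> = \<phi>\<^sup>2 * (1 / (2 * t)) ^ 4"
        using t by (simp add: \<phi>_def field_simps power2_eq_square power4_eq_xxxx)
      also have "\<dots> \<le> \<phi>\<^sup>2 * real L ^ 4"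
        using L t by (intro mult_left_mono power_mono) auto
      finally show ?thesis .
    qed
    moreover have "(\<bar>u\<bar> - 1) / 16 \<le> real L ^ 2"
    proof -
      have "\<bar>u\<bar> \<le> 4 / t\<^sup>2"
        using u pi_less_4 t by (smt (verit) divide_right_mono zero_le_power2)
      then have "(\<bar>u\<bar> - 1) / 16 \<le> (1 / (2 * t)) ^ 2"
        by (simp add: power_divide power_mult_distrib)
      also have "\<dots> \<le> real L ^ 2"
        using L t by (intro power_mono) auto
      finally show ?thesis .
    qed
    ultimately have "(\<bar>u\<bar> - 1) / 16 / 2 ^ 26 \<le> min (\<phi>\<^sup>2 * real L ^ 4) (real L ^ 2) / 2 ^ 26"
      by (intro divide_right_mono) auto
    also have "\<dots> \<le> G"
      unfolding G_def by (intro sum_sin_sq_ge L \<phi>)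
    finally show ?thesis by simp
  qed
  have G0: "G \<ge> 0" unfolding G_def by (intro sum_nonneg) auto
  \<comment> \<open>Splitting off the angle of T costs only a constant: weights are at most (r + 4)
    m, and \<alpha> = b t^2 gives \<alpha>^2 times the sum of m^3 at most b^2. The remaining main
    term is r G / 8, whence 2^33 = 8 * 2^30.\<close>
  have "(\<Sum>m=1..L. \<Sum>k<r * m. (sin ((\<phi> * real m + \<alpha> * real_of_int (weight r m k)) / 2))\<^sup>2 / 4) \<ge>
      (\<Sum>m=1..L. \<Sum>k<r * m. ((sin (\<phi> * real m / 2))\<^sup>2 / 2 - (\<bar>\<alpha>\<bar> * ((real r + 4) * real m) / 2)\<^sup>2) / 4)"
  proof (intro sum_mono divide_right_mono)
    fix m k assume "m \<in> {1..L}" "k \<in> {..<r * m}"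
    then have "\<bar>real_of_int (weight r m k)\<bar> \<le> (real r + 4) * real m"
      by (intro abs_weight_le) auto
    then have "\<bar>\<alpha> * real_of_int (weight r m k) / 2\<bar> \<le> \<bar>\<alpha>\<bar> * ((real r + 4) * real m) / 2"
      by (simp add: abs_mult mult_left_mono)
    then have "(\<alpha> * real_of_int (weight r m k) / 2)\<^sup>2 \<le> (\<bar>\<alpha>\<bar> * ((real r + 4) * real m) / 2)\<^sup>2"
      by (metis abs_ge_zero power2_abs power_mono)
    then show "(sin (\<phi> * real m / 2))\<^sup>2 / 2 - (\<bar>\<alpha>\<bar> * ((real r + 4) * real m) / 2)\<^sup>2 \<le>
        (sin ((\<phi> * real m + \<alpha> * real_of_int (weight r m k)) / 2))\<^sup>2"
      using sin_sq_add_ge[of "\<phi> * real m / 2" "\<alpha> * real_of_int (weight r m k) / 2"]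
      by (simp add: add_divide_distrib)
  qed auto
  also have "(\<Sum>m=1..L. \<Sum>k<r * m. ((sin (\<phi> * real m / 2))\<^sup>2 / 2 - (\<bar>\<alpha>\<bar> * ((real r + 4) * real m) / 2)\<^sup>2) / 4) =
      real r / 8 * G - real r * \<alpha>\<^sup>2 * (real r + 4)\<^sup>2 / 16 * (\<Sum>m=1..L. real m ^ 3)"
    unfolding G_def sum_distrib_left sum_subtractf[symmetric]
    by (intro sum.cong refl, simp add: power_mult_distrib power_divide)
      (simp add: field_simps power2_eq_square power3_eq_cube)
  finally have low: "real r / 8 * G - real r * \<alpha>\<^sup>2 * (real r + 4)\<^sup>2 / 16 * (\<Sum>m=1..L. real m ^ 3) \<le>
      (\<Sum>m=1..L. \<Sum>k<r * m. (sin ((\<phi> * real m + \<alpha> * real_of_int (weight r m k)) / 2))\<^sup>2 / 4)" .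
  have "(\<Sum>m=1..L. real m ^ 3) \<le> (\<Sum>m=1..L. real L ^ 3)"
    by (intro sum_mono power_mono) auto
  also have "\<dots> = real L ^ 4" by (simp add: eval_nat_numeral)
  also have "\<dots> \<le> (1 / t) ^ 4" using L by (intro power_mono) auto
  finally have "\<alpha>\<^sup>2 * (\<Sum>m=1..L. real m ^ 3) \<le> \<alpha>\<^sup>2 * (1 / t) ^ 4"
    by (intro mult_left_mono) auto
  also have "\<dots> = b\<^sup>2"
    using t by (simp add: \<alpha>_def field_simps power2_eq_square power4_eq_xxxx)
  finally have "(real r * (real r + 4)\<^sup>2 / 16) * (\<alpha>\<^sup>2 * (\<Sum>m=1..L. real m ^ 3)) \<le> (real r * (real r + 4)\<^sup>2 / 16) * b\<^sup>2"
    by (intro mult_left_mono) auto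
  moreover have "real r / 8 * G \<ge> 1 / 8 * G"
    using r G0 by (intro mult_right_mono divide_right_mono) auto
  ultimately have "(\<Sum>m=1..L. \<Sum>k<r * m. (sin ((\<phi> * real m + \<alpha> * real_of_int (weight r m k)) / 2))\<^sup>2 / 4) \<ge>
      \<bar>u\<bar> / 2 ^ 33 - 1 - real r * b\<^sup>2 * (real r + 4)\<^sup>2 / 16"
    using low G by (simp add: algebra_simps)
  moreover note norm_boltzmann_le_exp_sum[OF t(1) tL LN, of r \<phi> \<alpha>]
  ultimately show ?thesis
    unfolding \<phi>_def[symmetric] \<alpha>_def[symmetric]
    by (elim order_trans) simp
qed

text \<open>Second-order cumulant expansion of the pair (size, weight); the constants 3 and 26 are
  inherited from the moments of the weights, and the term with \<open>V 2\<close> is the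
  covariance.\<close>

lemma boltzmann_expansion:
  fixes r N t \<phi> \<alpha>
  defines "V \<equiv> \<lambda>a. \<Sum>m=1..N. real m ^ a * (bose t m * (1 + bose t m))"
  assumes t: "t > 0"
  obtains W where
    "boltzmann r N t \<phi> \<alpha> =
      exp (\<i> * of_real (real r * (\<phi> * (\<Sum>m=1..N. real m ^ 2 * bose t m) + 3 * \<alpha> * (\<Sum>m=1..N. real m ^ 1 * bose t m)))
         - of_real ((real r * \<phi>\<^sup>2 * V 3 + 6 * real r * \<phi> * \<alpha> * V 2 + \<alpha>\<^sup>2 * (real r ^ 3 * V 3 + 26 * real r * V 1) / 3) / 2) + W)"
    "norm W \<le> (\<Sum>m=1..N. \<Sum>k<r * m. bose t m * (1 + bose t m) * (1 + 2 * bose t m) *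
         \<bar>\<phi> * real m + \<alpha> * real_of_int (weight r m k)\<bar> ^ 3)"
proof -
  define y where "y m k = \<phi> * real m + \<alpha> * real_of_int (weight r m k)" for m k
  define q where "q m = bose t m * (1 + bose t m)" for m
  have "\<exists>w. geom_cf (bose t m) (y m k) = exp (\<i> * of_real (bose t m * y m k) - of_real (q m * (y m k)\<^sup>2 / 2) + w) \<and>
      norm w \<le> q m * (1 + 2 * bose t m) * \<bar>y m k\<bar> ^ 3" for m k
    unfolding q_def by (rule geom_cf_expansion[OF bose_nonneg[OF t], of m "y m k"]) blast
  then obtain w where w: "\<And>m k. geom_cf (bose t m) (y m k) =
        exp (\<i> * of_real (bose t m * y m k) - of_real (q m * (y m k)\<^sup>2 / 2) + w m k)"
      "\<And>m k. norm (w m k) \<le> q m * (1 + 2 * bose t m) * \<bar>y m k\<bar> ^ 3"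
    by metis
  have lin: "(\<Sum>m=1..N. \<Sum>k<r * m. bose t m * y m k) =
      real r * (\<phi> * (\<Sum>m=1..N. real m ^ 2 * bose t m) + 3 * \<alpha> * (\<Sum>m=1..N. real m ^ 1 * bose t m))"
  proof -
    have "(\<Sum>k<r * m. bose t m * y m k) =
        real r * (\<phi> * (real m ^ 2 * bose t m)) + real r * (3 * \<alpha> * (real m ^ 1 * bose t m))" for m
    proof -
      have "(\<Sum>k<r * m. y m k) = real (r * m) * (\<phi> * real m) + \<alpha> * (\<Sum>k<r * m. real_of_int (weight r m k))"
        by (simp add: y_def sum.distrib sum_distrib_left)
      then show ?thesis
        unfolding sum_weight sum_distrib_left[symmetric]
        by (simp add: algebra_simps power2_eq_square)
    qed
    then show ?thesis
      by (simp add: sum.distrib sum_distrib_left distrib_left)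
  qed
  have quad: "(\<Sum>m=1..N. \<Sum>k<r * m. q m * (y m k)\<^sup>2) =
      real r * \<phi>\<^sup>2 * V 3 + 6 * real r * \<phi> * \<alpha> * V 2 + \<alpha>\<^sup>2 * (real r ^ 3 * V 3 + 26 * real r * V 1) / 3"
  proof -
    have "(\<Sum>k<r * m. q m * (y m k)\<^sup>2) =
        real r * \<phi>\<^sup>2 * (real m ^ 3 * q m) + 6 * real r * \<phi> * \<alpha> * (real m ^ 2 * q m) +
        (\<alpha>\<^sup>2 * real r ^ 3 / 3 * (real m ^ 3 * q m) + \<alpha>\<^sup>2 * (26 * real r) / 3 * (real m ^ 1 * q m))" for m
    proof -
      have "(\<Sum>k<r * m. (y m k)\<^sup>2) = real (r * m) * (\<phi> * real m)\<^sup>2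
          + 2 * (\<phi> * real m) * \<alpha> * (\<Sum>k<r * m. real_of_int (weight r m k))
          + \<alpha>\<^sup>2 * (\<Sum>k<r * m. (real_of_int (weight r m k))\<^sup>2)"
        by (simp add: y_def power2_sum sum.distrib sum_distrib_left power_mult_distrib mult_ac)
      then show ?thesis
        unfolding sum_weight sum_distrib_left[symmetric]
        by (simp add: algebra_simps power2_eq_square power3_eq_cube)
    qed
    then have "(\<Sum>m=1..N. \<Sum>k<r * m. q m * (y m k)\<^sup>2) =
        real r * \<phi>\<^sup>2 * V 3 + 6 * real r * \<phi> * \<alpha> * V 2 +
        (\<alpha>\<^sup>2 * real r ^ 3 / 3 * V 3 + \<alpha>\<^sup>2 * (26 * real r) / 3 * V 1)"
      unfolding V_def q_def[symmetric] sum_distrib_left sum.distrib[symmetric] by (intro sum.cong) auto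
    then show ?thesis by (simp add: field_simps)
  qed
  define W where "W = (\<Sum>m=1..N. \<Sum>k<r * m. w m k)"
  have "boltzmann r N t \<phi> \<alpha> = (\<Prod>m=1..N. \<Prod>k<r * m. geom_cf (bose t m) (y m k))"
    by (simp add: boltzmann_def y_def)
  also have "\<dots> = exp (\<Sum>m=1..N. \<Sum>k<r * m. \<i> * of_real (bose t m * y m k) - of_real (q m * (y m k)\<^sup>2 / 2) + w m k)"
    unfolding w(1) by (simp add: exp_sum)
  also have "(\<Sum>m=1..N. \<Sum>k<r * m. \<i> * of_real (bose t m * y m k) - of_real (q m * (y m k)\<^sup>2 / 2) + w m k) =
      \<i> * of_real (\<Sum>m=1..N. \<Sum>k<r * m. bose t m * y m k)
      - of_real ((\<Sum>m=1..N. \<Sum>k<r * m. q m * (y m k)\<^sup>2) / 2) + W"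
    by (simp add: W_def sum.distrib sum_subtractf sum_distrib_left sum_divide_distrib)
  finally have "boltzmann r N t \<phi> \<alpha> = exp (\<i> * of_real (\<Sum>m=1..N. \<Sum>k<r * m. bose t m * y m k)
      - of_real ((\<Sum>m=1..N. \<Sum>k<r * m. q m * (y m k)\<^sup>2) / 2) + W)" .
  moreover have "norm W \<le> (\<Sum>m=1..N. \<Sum>k<r * m. q m * (1 + 2 * bose t m) * \<bar>y m k\<bar> ^ 3)"
    unfolding W_def using w(2) by (intro sum_norm_le) auto
  ultimately show ?thesis
    using that[of W] unfolding lin quad unfolding q_def y_def by blast
qed

text \<open>On level \<open>m\<close> the angle is at most t^2 m times a constant, and 1 + 2 p is at
  most 1 + 2 / (t m). The two resulting sums are of order t^-5 and t^-4, so the cubic error is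
  O(t).\<close>

lemma boltzmann_error_le:
  assumes t: "t > 0"
  shows "(\<Sum>m=1..N. \<Sum>k<r * m. bose t m * (1 + bose t m) * (1 + 2 * bose t m) *
         \<bar>t\<^sup>2 * u * real m + b * t\<^sup>2 * real_of_int (weight r m k)\<bar> ^ 3) \<le>
     real r * (\<bar>u\<bar> + \<bar>b\<bar> * (real r + 4)) ^ 3 *
       (t ^ 6 * (\<Sum>m=1..N. real m ^ 4 * (bose t m * (1 + bose t m)))
        + 2 * t ^ 5 * (\<Sum>m=1..N. real m ^ 3 * (bose t m * (1 + bose t m))))"
proof -
  define K where "K = \<bar>u\<bar> + \<bar>b\<bar> * (real r + 4)"
  define q where "q m = bose t m * (1 + bose t m)" for m
  have q: "q m \<ge> 0" for m using bose_nonneg[OF t, of m] by (simp add: q_def)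
  have K: "K \<ge> 0" by (simp add: K_def)
  have "(\<Sum>k<r * m. q m * (1 + 2 * bose t m) * \<bar>t\<^sup>2 * u * real m + b * t\<^sup>2 * real_of_int (weight r m k)\<bar> ^ 3)
      \<le> real r * K ^ 3 * (t ^ 6 * (real m ^ 4 * q m)) + real r * K ^ 3 * (2 * t ^ 5 * (real m ^ 3 * q m))"
    if m: "m \<in> {1..N}" for m
  proof -
    have "(\<Sum>k<r * m. q m * (1 + 2 * bose t m) * \<bar>t\<^sup>2 * u * real m + b * t\<^sup>2 * real_of_int (weight r m k)\<bar> ^ 3)
      \<le> (\<Sum>k<r * m. q m * (1 + 2 / (t * real m)) * (t\<^sup>2 * real m * K) ^ 3)"
    proof (intro sum_mono mult_mono power_mono)
      fix k assume "k \<in> {..<r * m}"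
      then have "\<bar>real_of_int (weight r m k)\<bar> \<le> (real r + 4) * real m"
        using m by (intro abs_weight_le) auto
      then have "\<bar>b\<bar> * t\<^sup>2 * \<bar>real_of_int (weight r m k)\<bar> \<le> \<bar>b\<bar> * t\<^sup>2 * ((real r + 4) * real m)"
        by (intro mult_left_mono) auto
      moreover have "\<bar>t\<^sup>2 * u * real m + b * t\<^sup>2 * real_of_int (weight r m k)\<bar> \<le>
          t\<^sup>2 * \<bar>u\<bar> * real m + \<bar>b\<bar> * t\<^sup>2 * \<bar>real_of_int (weight r m k)\<bar>"
        by (rule order_trans[OF abs_triangle_ineq]) (simp add: abs_mult)
      ultimately show "\<bar>t\<^sup>2 * u * real m + b * t\<^sup>2 * real_of_int (weight r m k)\<bar> \<le> t\<^sup>2 * real m * K"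
        by (simp add: K_def algebra_simps)
      show "1 + 2 * bose t m \<le> 1 + 2 / (t * real m)"
        using bose_le[OF t, of m] m by simp
    qed (use q t bose_nonneg[OF t, of m] in auto)
    also have "\<dots> = real r * K ^ 3 * (t ^ 6 * (real m ^ 4 * q m)) + real r * K ^ 3 * (2 * t ^ 5 * (real m ^ 3 * q m))"
      using t m by (simp add: field_simps eval_nat_numeral)
    finally show ?thesis .
  qed
  then have "(\<Sum>m=1..N. \<Sum>k<r * m. q m * (1 + 2 * bose t m) * \<bar>t\<^sup>2 * u * real m + b * t\<^sup>2 * real_of_int (weight r m k)\<bar> ^ 3)
      \<le> (\<Sum>m=1..N. real r * K ^ 3 * (t ^ 6 * (real m ^ 4 * q m)) + real r * K ^ 3 * (2 * t ^ 5 * (real m ^ 3 * q m)))"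
    by (intro sum_mono)
  then show ?thesis
    by (simp add: K_def q_def sum.distrib sum_distrib_left distrib_left)
qed

section \<open>Truncation and the pointwise limit of the integrand\<close>

lemma sums_imp_LIMSEQ_from_1:
  fixes f :: "nat \<Rightarrow> real"
  assumes "f sums s" "f 0 = 0"
  shows "(\<lambda>N. \<Sum>m=1..N. f m) \<longlonglongrightarrow> s"
proof -
  have "(\<lambda>N. \<Sum>m\<le>N. f m) \<longlonglongrightarrow> s"
    using assms(1) by (simp add: sums_def_le)
  moreover have "(\<Sum>m\<le>N. f m) = (\<Sum>m=1..N. f m)" for N
  proof -
    have "{..N} = insert 0 {1..N}" by auto
    then show ?thesis using assms(2) by simp
  qed
  ultimately show ?thesis by simp
qed

text \<open>Only the factors with \<open>m \<le> n\<close> influence the coefficient of \<open>q ^ n\<close>, so the product may be cut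
  off at any later \<open>N\<close>; choosing \<open>N\<close> after \<open>t\<close> makes all truncation errors harmless.\<close>

lemma truncation_exists:
  assumes t: "t > 0"
  shows "\<exists>N. n < N \<and> 1 / t \<le> real N \<and>
    \<bar>(\<Sum>m=1..N. real m ^ 1 * bose t m) - (\<Sum>m. real m ^ 1 * bose t m)\<bar> \<le> 1 \<and>
    \<bar>(\<Sum>m=1..N. real m ^ 2 * bose t m) - (\<Sum>m. real m ^ 2 * bose t m)\<bar> \<le> 1 \<and>
    \<bar>(\<Sum>m=1..N. real m ^ 3 * (bose t m * (1 + bose t m))) - (\<Sum>m. real m ^ 3 * (bose t m * (1 + bose t m)))\<bar> \<le> 1"
proof -
  have ev: "eventually (\<lambda>N. \<bar>(\<Sum>m=1..N. f m) - suminf f\<bar> \<le> 1) sequentially"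
    if "f sums s" "f 0 = 0" for f :: "nat \<Rightarrow> real" and s
    using tendstoD[OF sums_imp_LIMSEQ_from_1[OF that], of 1] sums_unique[OF that(1)]
    by (auto simp: dist_real_def elim!: eventually_mono)
  have "eventually (\<lambda>N. n < N) sequentially" "eventually (\<lambda>N. 1 / t \<le> real N) sequentially"
    by (rule eventually_gt_at_top, real_asymp)
  then have "eventually (\<lambda>N. n < N \<and> 1 / t \<le> real N \<and>
    \<bar>(\<Sum>m=1..N. real m ^ 1 * bose t m) - (\<Sum>m. real m ^ 1 * bose t m)\<bar> \<le> 1 \<and>
    \<bar>(\<Sum>m=1..N. real m ^ 2 * bose t m) - (\<Sum>m. real m ^ 2 * bose t m)\<bar> \<le> 1 \<and>
    \<bar>(\<Sum>m=1..N. real m ^ 3 * (bose t m * (1 + bose t m))) - (\<Sum>m. real m ^ 3 * (bose t m * (1 + bose t m)))\<bar> \<le> 1) sequentially"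
    by (intro eventually_conj ev[OF sums_bose(2)[OF t, of 1]] ev[OF sums_bose(2)[OF t, of 2]] ev[OF sums_bose_var(2)[OF t, of 3]]) auto
  then show ?thesis
    by (rule eventually_happens'[rotated]) simp
qed

lemma truncated_var_le:
  assumes t: "t > 0" and a: "a \<ge> 2"
  shows "(\<Sum>m=1..N. real m ^ a * (bose t m * (1 + bose t m))) \<le> fact a * 2 ^ Suc a * (\<Sum>j. 1 / real (Suc j) ^ a) / t ^ Suc a"
    and "(\<Sum>m=1..N. real m ^ a * (bose t m * (1 + bose t m))) \<ge> 0"
proof -
  have nn: "real m ^ a * (bose t m * (1 + bose t m)) \<ge> 0" for m
    using bose_nonneg[OF t, of m] by simp
  have "(\<Sum>m=1..N. real m ^ a * (bose t m * (1 + bose t m))) \<le> (\<Sum>m. real m ^ a * (bose t m * (1 + bose t m)))"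
    using sums_bose_var(2)[OF t a] nn by (intro sum_le_suminf) (auto simp: sums_iff)
  also have "\<dots> \<le> fact a * 2 ^ Suc a * (\<Sum>j. 1 / real (Suc j) ^ a) / t ^ Suc a"
    using sums_bose_var[OF t a] by (simp add: sums_iff del: of_nat_Suc)
  finally show "(\<Sum>m=1..N. real m ^ a * (bose t m * (1 + bose t m))) \<le> fact a * 2 ^ Suc a * (\<Sum>j. 1 / real (Suc j) ^ a) / t ^ Suc a" .
  show "(\<Sum>m=1..N. real m ^ a * (bose t m * (1 + bose t m))) \<ge> 0"
    using nn by (intro sum_nonneg) auto
qed

lemma boltzmann_tendsto:
  fixes t :: "nat \<Rightarrow> real" and N :: "nat \<Rightarrow> nat"
  assumes t: "\<And>n. t n > 0" and lim: "filterlim t (at_right 0) sequentially"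
    and n: "\<And>n. n > 0 \<Longrightarrow> real n * t n ^ 3 = 2 * real r * zeta 3"
    and N: "\<And>n. \<bar>(\<Sum>m=1..N n. real m ^ 1 * bose (t n) m) - (\<Sum>m. real m ^ 1 * bose (t n) m)\<bar> \<le> 1"
      "\<And>n. \<bar>(\<Sum>m=1..N n. real m ^ 2 * bose (t n) m) - (\<Sum>m. real m ^ 2 * bose (t n) m)\<bar> \<le> 1"
      "\<And>n. \<bar>(\<Sum>m=1..N n. real m ^ 3 * (bose (t n) m * (1 + bose (t n) m))) -
          (\<Sum>m. real m ^ 3 * (bose (t n) m * (1 + bose (t n) m)))\<bar> \<le> 1"
  shows "(\<lambda>n. boltzmann r (N n) (t n) ((t n)\<^sup>2 * u) (b * (t n)\<^sup>2) * cis (- (real n * ((t n)\<^sup>2 * u))))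
    \<longlonglongrightarrow> exp (\<i> * of_real (b * real r * pi\<^sup>2 / 2) - of_real (zeta 3 * real r ^ 3 * b\<^sup>2)) *
      of_real (exp (- (3 * real r * zeta 3 * u\<^sup>2)))"
proof -
  define A where "A a n = (\<Sum>m=1..N n. real m ^ a * bose (t n) m)" for a n
  define V where "V a n = (\<Sum>m=1..N n. real m ^ a * (bose (t n) m * (1 + bose (t n) m)))" for a n
  have t0: "t \<longlonglongrightarrow> 0"
    using lim by (simp add: filterlim_at)
  \<comment> \<open>Truncation errors are bounded by 1, hence vanish after multiplication by any
    positive power of \<open>t\<close>.\<close>
  have trunc: "(\<lambda>n. t n ^ k * x n) \<longlonglongrightarrow> l"
    if "\<And>n. \<bar>x n - s n\<bar> \<le> 1" "(\<lambda>n. t n ^ k * s n) \<longlonglongrightarrow> l" "k > 0" for x s l k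
  proof -
    have "(\<lambda>n. t n ^ k * (x n - s n)) \<longlonglongrightarrow> 0"
    proof (rule Lim_null_comparison)
      show "eventually (\<lambda>n. norm (t n ^ k * (x n - s n)) \<le> t n ^ k) sequentially"
        using that(1) t by (intro always_eventually allI) (auto simp: abs_mult less_imp_le mult_left_le)
      show "(\<lambda>n. t n ^ k) \<longlonglongrightarrow> 0"
        using tendsto_power[OF t0, of k] that(3) by (simp add: power_0_left)
    qed
    from tendsto_add[OF this that(2)] show ?thesis by (simp add: algebra_simps)
  qed
  have A1: "(\<lambda>n. t n ^ 2 * A 1 n) \<longlonglongrightarrow> pi\<^sup>2 / 6"
    unfolding A_def by (rule trunc[OF N(1) filterlim_compose[OF tendsto_bose_sums(1) lim]]) simp
  have A2: "(\<lambda>n. t n ^ 2 * (A 2 n - 2 * zeta 3 / t n ^ 3)) \<longlonglongrightarrow> 0"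
    unfolding A_def by (rule trunc[OF _ filterlim_compose[OF tendsto_bose_sums(2) lim]]) (use N(2) in simp_all)
  have V3: "(\<lambda>n. t n ^ 4 * V 3 n) \<longlonglongrightarrow> 6 * zeta 3"
    unfolding V_def by (rule trunc[OF N(3) filterlim_compose[OF tendsto_bose_sums(3) lim]]) simp
  have small: "(\<lambda>n. t n ^ Suc (Suc a) * V a n) \<longlonglongrightarrow> 0" if a: "a \<ge> 2" for a
  proof (rule Lim_null_comparison)
    define C where "C = fact a * 2 ^ Suc a * (\<Sum>j. 1 / real (Suc j) ^ a)"
    show "eventually (\<lambda>n. norm (t n ^ Suc (Suc a) * V a n) \<le> t n * C) sequentially"
    proof (intro always_eventually allI)
      fix n
      have "t n ^ Suc (Suc a) * V a n \<le> t n ^ Suc (Suc a) * (C / t n ^ Suc a)"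
        unfolding V_def C_def using t[of n] by (intro mult_left_mono truncated_var_le(1)[OF t a]) auto
      also have "\<dots> = t n * C" using t[of n] by simp
      finally show "norm (t n ^ Suc (Suc a) * V a n) \<le> t n * C"
        using t[of n] truncated_var_le(2)[OF t a, where N = "N n"] by (simp add: V_def)
    qed
    show "(\<lambda>n. t n * C) \<longlonglongrightarrow> 0"
      using tendsto_mult_right[OF t0, of C] by simp
  qed
  \<comment> \<open>The covariance sum is one order smaller than the variance sum
    \<open>V 3\<close>, so the mixed term disappears in the limit.\<close>
  have V2: "(\<lambda>n. t n ^ 4 * V 2 n) \<longlonglongrightarrow> 0"
    using small[of 2] by (simp add: eval_nat_numeral)
  \<comment> \<open>The bound behind \<open>small\<close> would be the divergent harmonic series for
    exponent 1; comparison with \<open>V 2\<close> is enough.\<close>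
  have V1: "(\<lambda>n. t n ^ 4 * V 1 n) \<longlonglongrightarrow> 0"
  proof (rule Lim_null_comparison[OF always_eventually V2], intro allI)
    fix n
    have "0 \<le> V 1 n" unfolding V_def using bose_nonneg[OF t[of n]] by (intro sum_nonneg) auto
    moreover have "V 1 n \<le> V 2 n" unfolding V_def
      using bose_nonneg[OF t[of n]] by (intro sum_mono mult_right_mono power_increasing) auto
    ultimately show "norm (t n ^ 4 * V 1 n) \<le> t n ^ 4 * V 2 n"
      using t[of n] by (simp add: abs_mult mult_left_mono)
  qed
  define X where "X n = real r * ((t n)\<^sup>2 * u * A 2 n + 3 * (b * (t n)\<^sup>2) * A 1 n) - real n * ((t n)\<^sup>2 * u)" for n
  define Y where "Y n = (real r * ((t n)\<^sup>2 * u)\<^sup>2 * V 3 n + 6 * real r * ((t n)\<^sup>2 * u) * (b * (t n)\<^sup>2) * V 2 n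
      + (b * (t n)\<^sup>2)\<^sup>2 * (real r ^ 3 * V 3 n + 26 * real r * V 1 n) / 3) / 2" for n
  have "\<exists>W. boltzmann r (N n) (t n) ((t n)\<^sup>2 * u) (b * (t n)\<^sup>2) * cis (- (real n * ((t n)\<^sup>2 * u))) =
          exp (\<i> * of_real (X n) - of_real (Y n) + W) \<and>
        norm W \<le> real r * (\<bar>u\<bar> + \<bar>b\<bar> * (real r + 4)) ^ 3 * (t n ^ 6 * V 4 n + 2 * t n ^ 5 * V 3 n)" for n
  proof -
    obtain W where W: "boltzmann r (N n) (t n) ((t n)\<^sup>2 * u) (b * (t n)\<^sup>2) =
        exp (\<i> * of_real (real r * ((t n)\<^sup>2 * u * A 2 n + 3 * (b * (t n)\<^sup>2) * A 1 n)) - of_real (Y n) + W)"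
      "norm W \<le> (\<Sum>m=1..N n. \<Sum>k<r * m. bose (t n) m * (1 + bose (t n) m) * (1 + 2 * bose (t n) m) *
         \<bar>(t n)\<^sup>2 * u * real m + b * (t n)\<^sup>2 * real_of_int (weight r m k)\<bar> ^ 3)"
      unfolding A_def V_def Y_def by (rule boltzmann_expansion[OF t[of n], of r "N n" "(t n)\<^sup>2 * u" "b * (t n)\<^sup>2"]) blast
    have "boltzmann r (N n) (t n) ((t n)\<^sup>2 * u) (b * (t n)\<^sup>2) * cis (- (real n * ((t n)\<^sup>2 * u))) =
          exp (\<i> * of_real (X n) - of_real (Y n) + W)"
      unfolding W(1) cis_conv_exp exp_add[symmetric] X_def by (rule arg_cong[of _ _ exp]) (simp add: algebra_simps)
    then show ?thesis
      using order_trans[OF W(2) boltzmann_error_le[OF t]] unfolding V_def by blast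
  qed
  then obtain W where W: "\<And>n. boltzmann r (N n) (t n) ((t n)\<^sup>2 * u) (b * (t n)\<^sup>2) * cis (- (real n * ((t n)\<^sup>2 * u))) =
          exp (\<i> * of_real (X n) - of_real (Y n) + W n)"
      "\<And>n. norm (W n) \<le> real r * (\<bar>u\<bar> + \<bar>b\<bar> * (real r + 4)) ^ 3 * (t n ^ 6 * V 4 n + 2 * t n ^ 5 * V 3 n)"
    by metis
  have W0: "W \<longlonglongrightarrow> 0"
  proof (rule Lim_null_comparison[OF always_eventually], intro allI, rule W(2))
    have "(\<lambda>n. real r * (\<bar>u\<bar> + \<bar>b\<bar> * (real r + 4)) ^ 3 * (t n ^ 6 * V 4 n + 2 * (t n ^ 5 * V 3 n))) \<longlonglongrightarrow>
        real r * (\<bar>u\<bar> + \<bar>b\<bar> * (real r + 4)) ^ 3 * (0 + 2 * 0)"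
      using small[of 4] small[of 3] by (intro tendsto_intros) (simp_all add: eval_nat_numeral)
    then show "(\<lambda>n. real r * (\<bar>u\<bar> + \<bar>b\<bar> * (real r + 4)) ^ 3 * (t n ^ 6 * V 4 n + 2 * t n ^ 5 * V 3 n)) \<longlonglongrightarrow> 0"
      by (simp add: mult.assoc)
  qed
  have "(\<lambda>n. real r * u * (t n ^ 2 * (A 2 n - 2 * zeta 3 / t n ^ 3)) + 3 * b * real r * (t n ^ 2 * A 1 n)) \<longlonglongrightarrow>
      real r * u * 0 + 3 * b * real r * (pi\<^sup>2 / 6)"
    by (intro tendsto_intros A1 A2)
  \<comment> \<open>The saddle point condition enters here: n t^2 u equals r u t^2 (2 \<zeta>(3) /
    t^3), so the divergent part of the mean size cancels against the phase of
    \<open>cis\<close>.\<close>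
  moreover have "eventually (\<lambda>n. real r * u * (t n ^ 2 * (A 2 n - 2 * zeta 3 / t n ^ 3)) + 3 * b * real r * (t n ^ 2 * A 1 n) = X n) sequentially"
  proof (rule eventually_mono[OF eventually_gt_at_top[of 0]])
    fix k :: nat assume "k > 0"
    from n[OF this] have "real k = 2 * real r * zeta 3 / t k ^ 3"
      using t[of k] by (simp add: field_simps)
    then show "real r * u * (t k ^ 2 * (A 2 k - 2 * zeta 3 / t k ^ 3)) + 3 * b * real r * (t k ^ 2 * A 1 k) = X k"
      unfolding X_def by (simp add: algebra_simps)
  qed
  ultimately have X: "X \<longlonglongrightarrow> b * real r * pi\<^sup>2 / 2"
    by (auto dest: Lim_transform_eventually simp: field_simps)
  have "(\<lambda>n. (real r * u\<^sup>2 * (t n ^ 4 * V 3 n) + 6 * real r * u * b * (t n ^ 4 * V 2 n)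
      + b\<^sup>2 * (real r ^ 3 * (t n ^ 4 * V 3 n) + 26 * real r * (t n ^ 4 * V 1 n)) / 3) / 2) \<longlonglongrightarrow>
      (real r * u\<^sup>2 * (6 * zeta 3) + 6 * real r * u * b * 0 + b\<^sup>2 * (real r ^ 3 * (6 * zeta 3) + 26 * real r * 0) / 3) / 2"
    by (intro tendsto_intros V1 V2 V3) auto
  moreover have "(real r * u\<^sup>2 * (t n ^ 4 * V 3 n) + 6 * real r * u * b * (t n ^ 4 * V 2 n)
      + b\<^sup>2 * (real r ^ 3 * (t n ^ 4 * V 3 n) + 26 * real r * (t n ^ 4 * V 1 n)) / 3) / 2 = Y n" for n
    unfolding Y_def by (simp add: algebra_simps eval_nat_numeral)
  moreover have "(real r * u\<^sup>2 * (6 * zeta 3) + 6 * real r * u * b * 0 + b\<^sup>2 * (real r ^ 3 * (6 * zeta 3) + 26 * real r * 0) / 3) / 2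
      = 3 * real r * zeta 3 * u\<^sup>2 + zeta 3 * real r ^ 3 * b\<^sup>2"
    by (simp add: field_simps)
  ultimately have Y: "Y \<longlonglongrightarrow> 3 * real r * zeta 3 * u\<^sup>2 + zeta 3 * real r ^ 3 * b\<^sup>2"
    by (simp only:)
  have "(\<lambda>n. exp (\<i> * of_real (X n) - of_real (Y n) + W n)) \<longlonglongrightarrow>
      exp (\<i> * of_real (b * real r * pi\<^sup>2 / 2) - of_real (3 * real r * zeta 3 * u\<^sup>2 + zeta 3 * real r ^ 3 * b\<^sup>2) + 0)"
    by (intro tendsto_intros X Y W0)
  also have "exp (\<i> * of_real (b * real r * pi\<^sup>2 / 2) - of_real (3 * real r * zeta 3 * u\<^sup>2 + zeta 3 * real r ^ 3 * b\<^sup>2) + 0) =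
      exp (\<i> * of_real (b * real r * pi\<^sup>2 / 2) - of_real (zeta 3 * real r ^ 3 * b\<^sup>2)) *
      of_real (exp (- (3 * real r * zeta 3 * u\<^sup>2)))"
    unfolding exp_of_real[symmetric] exp_add[symmetric] by (rule arg_cong[of _ _ exp]) simp
  finally show ?thesis unfolding W(1) .
qed

subsection \<open>Convergence of the characteristic functions\<close>

lemma continuous_on_geom_cf:
  assumes "p \<ge> 0"
  shows "continuous_on UNIV (geom_cf p)"
proof -
  have "1 - of_real p * (cis y - 1) \<noteq> 0" for y
  proof -
    have "p * cos y \<le> p * 1" using assms by (intro mult_left_mono) auto
    then have "Re (1 - of_real p * (cis y - 1)) \<ge> 1"
      by (simp add: algebra_simps)
    then show ?thesis by (metis not_one_le_zero zero_complex.simps(1))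
  qed
  then show ?thesis
    unfolding geom_cf_def[abs_def] by (intro continuous_intros) auto
qed

lemma continuous_on_boltzmann:
  assumes "t > 0"
  shows "continuous_on UNIV (\<lambda>x. boltzmann r N t x \<alpha>)"
  unfolding boltzmann_def
  by (intro continuous_on_prod continuous_on_compose2[OF continuous_on_geom_cf[OF bose_nonneg[OF assms]]] continuous_intros) auto

text \<open>The exponential density plus its reflection, divided by \<open>c\<close>, dominates the
  two-sided exponential.\<close>

lemma integrable_exp_neg_abs:
  fixes c :: real
  assumes "c > 0"
  shows "integrable lborel (\<lambda>x. exp (- c * \<bar>x\<bar>))"
proof -
  have "integrable lborel (exponential_density c)"
  proof (rule integrableI_nonneg)
    have "emeasure (density lborel (exponential_density c)) UNIV = 1"
      using prob_space.emeasure_space_1[OF prob_space_exponential_density[OF assms]] by simp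
    then show "(\<integral>\<^sup>+x. ennreal (exponential_density c x) \<partial>lborel) < \<infinity>"
      by (subst (asm) emeasure_density) auto
  qed (use assms in \<open>auto simp: exponential_density_def\<close>)
  then have i: "integrable lborel (\<lambda>x. exponential_density c x / c)"
    by simp
  have "integrable lborel (\<lambda>x. exponential_density c (0 + (-1) * x) / c)"
    using lborel_integrable_real_affine[OF i, of "-1" 0] by simp
  with i have "integrable lborel (\<lambda>x. exponential_density c x / c + exponential_density c (0 + (-1) * x) / c)"
    by (rule Bochner_Integration.integrable_add)
  then show ?thesis
    by (rule Bochner_Integration.integrable_bound)
      (use assms in \<open>auto simp: exponential_density_def mult.commute\<close>)
qed

lemma exp_square_eq_normal_density:
  assumes "c > 0"
  shows "exp (- (c * x\<^sup>2)) = sqrt (pi / c) * normal_density 0 (1 / sqrt (2 * c)) x"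
  using assms by (simp add: normal_density_def power_divide field_simps)

lemma integral_exp_square: "c > 0 \<Longrightarrow> (LINT x|lborel. exp (- (c * x\<^sup>2))) = sqrt (pi / c)"
  by (simp add: exp_square_eq_normal_density)

lemma circle_integral_tendsto:
  fixes t :: "nat \<Rightarrow> real" and N :: "nat \<Rightarrow> nat"
  assumes r: "r \<ge> 1" and t: "\<And>n. t n > 0" and lim: "filterlim t (at_right 0) sequentially"
    and n: "\<And>n. n > 0 \<Longrightarrow> real n * t n ^ 3 = 2 * real r * zeta 3"
    and N0: "\<And>n. 1 / t n \<le> real (N n)"
    and N: "\<And>n. \<bar>(\<Sum>m=1..N n. real m ^ 1 * bose (t n) m) - (\<Sum>m. real m ^ 1 * bose (t n) m)\<bar> \<le> 1"
      "\<And>n. \<bar>(\<Sum>m=1..N n. real m ^ 2 * bose (t n) m) - (\<Sum>m. real m ^ 2 * bose (t n) m)\<bar> \<le> 1"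
      "\<And>n. \<bar>(\<Sum>m=1..N n. real m ^ 3 * (bose (t n) m * (1 + bose (t n) m))) -
          (\<Sum>m. real m ^ 3 * (bose (t n) m * (1 + bose (t n) m)))\<bar> \<le> 1"
  shows "(\<lambda>n. (LINT x:{-pi..pi}|lborel. boltzmann r (N n) (t n) x (b * (t n)\<^sup>2) * cis (- (real n * x))) / of_real ((t n)\<^sup>2))
    \<longlonglongrightarrow> exp (\<i> * of_real (b * real r * pi\<^sup>2 / 2) - of_real (zeta 3 * real r ^ 3 * b\<^sup>2)) *
       of_real (sqrt (pi / (3 * real r * zeta 3)))"
proof -
  define E where "E = exp (\<i> * of_real (b * real r * pi\<^sup>2 / 2) - of_real (zeta 3 * real r ^ 3 * b\<^sup>2))"
  define c where "c = 3 * real r * zeta 3"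
  have c: "c > 0" using r zeta_3_pos by (simp add: c_def)
  define F where "F n x = boltzmann r (N n) (t n) x (b * (t n)\<^sup>2) * cis (- (real n * x))" for n x
  \<comment> \<open>The rescaled integrand extended by 0 to the real line, so that the growing
    ranges |u| at most pi / t^2 share one domain.\<close>
  define K where "K n u = indicator {-pi..pi} ((t n)\<^sup>2 * u) *\<^sub>R F n ((t n)\<^sup>2 * u)" for n u
  have int: "(LINT x:{-pi..pi}|lborel. F n x) / of_real ((t n)\<^sup>2) = (LINT u|lborel. K n u)" for n
    unfolding set_lebesgue_integral_def K_def using t[of n]
    by (subst lborel_integral_real_affine[where c = "(t n)\<^sup>2" and t = 0]) (auto simp: scaleR_conv_of_real)
  have contF: "continuous_on UNIV (F n)" for n
    unfolding F_def by (intro continuous_intros continuous_on_boltzmann t)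
  have [measurable]: "F n \<in> borel_measurable borel" for n
    by (rule borel_measurable_continuous_onI[OF contF])
  have Km: "K n \<in> borel_measurable lborel" for n
    unfolding K_def by measurable
  have t0: "t \<longlonglongrightarrow> 0"
    using lim by (simp add: filterlim_at)
  then have "eventually (\<lambda>n. t n < 1 / 64) sequentially"
    by (rule order_tendstoD) simp
  then obtain n0 where n0: "\<And>n. n \<ge> n0 \<Longrightarrow> t n < 1 / 64"
    by (auto simp: eventually_sequentially)
  \<comment> \<open>This majorant is available only once \<open>t n \<le> 1 / 64\<close>, so
    dominated convergence is applied to the sequence shifted by \<open>n0\<close>.\<close>
  define w where "w u = exp (real r * b\<^sup>2 * (real r + 4)\<^sup>2 / 16 + 1) * exp (- (1 / 2 ^ 33) * \<bar>u\<bar>)" for u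
  have "(\<lambda>n. LINT u|lborel. K (n + n0) u) \<longlonglongrightarrow> (LINT u|lborel. E * of_real (exp (- (c * u\<^sup>2))))"
  proof (rule integral_dominated_convergence)
    show "integrable lborel w"
      unfolding w_def by (intro integrable_mult_right integrable_exp_neg_abs) simp
    show "AE u in lborel. (\<lambda>n. K (n + n0) u) \<longlonglongrightarrow> E * of_real (exp (- (c * u\<^sup>2)))"
    proof (rule AE_I2)
      fix u
      have "(\<lambda>n. (t n)\<^sup>2 * u) \<longlonglongrightarrow> 0\<^sup>2 * u"
        by (intro tendsto_intros t0)
      then have "eventually (\<lambda>n. -pi < (t n)\<^sup>2 * u) sequentially" "eventually (\<lambda>n. (t n)\<^sup>2 * u < pi) sequentially"
        by (auto intro: order_tendstoD)
      then have "eventually (\<lambda>n. F n ((t n)\<^sup>2 * u) = K n u) sequentially"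
        by eventually_elim (auto simp: K_def)
      moreover have "(\<lambda>n. F n ((t n)\<^sup>2 * u)) \<longlonglongrightarrow> E * of_real (exp (- (c * u\<^sup>2)))"
        using boltzmann_tendsto[OF t lim n N, of u b] by (simp add: F_def E_def c_def)
      ultimately have "(\<lambda>n. K n u) \<longlonglongrightarrow> E * of_real (exp (- (c * u\<^sup>2)))"
        by (rule Lim_transform_eventually[rotated])
      then show "(\<lambda>n. K (n + n0) u) \<longlonglongrightarrow> E * of_real (exp (- (c * u\<^sup>2)))"
        by (rule LIMSEQ_ignore_initial_segment)
    qed
    show "AE u in lborel. norm (K (n + n0) u) \<le> w u" for n
    proof (rule AE_I2)
      fix u
      let ?n = "n + n0"
      show "norm (K ?n u) \<le> w u"
      proof (cases "(t ?n)\<^sup>2 * u \<in> {-pi..pi}")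
        case True
        then have "\<bar>u\<bar> \<le> pi / (t ?n)\<^sup>2"
          using t[of ?n] by (auto simp: abs_le_iff field_simps)
        then have "norm (boltzmann r (N ?n) (t ?n) ((t ?n)\<^sup>2 * u) (b * (t ?n)\<^sup>2)) \<le>
            exp (real r * b\<^sup>2 * (real r + 4)\<^sup>2 / 16 + 1 - \<bar>u\<bar> / 2 ^ 33)"
          using n0[of ?n] by (intro norm_boltzmann_le r t N0) auto
        with True show ?thesis
          by (simp add: K_def F_def w_def norm_mult flip: exp_add)
      next
        case False
        then show ?thesis by (simp add: K_def w_def)
      qed
    qed
  qed (use Km in auto)
  also have "(LINT u|lborel. E * of_real (exp (- (c * u\<^sup>2)))) = E * of_real (sqrt (pi / c))"
    unfolding integral_mult_right_zero integral_complex_of_real integral_exp_square[OF c] ..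
  finally have "(\<lambda>n. LINT u|lborel. K n u) \<longlonglongrightarrow> E * of_real (sqrt (pi / c))"
    by (rule LIMSEQ_offset)
  then show ?thesis
    unfolding int[symmetric] F_def E_def c_def by simp
qed

lemma tendsto_laurent_evalc_DT_coeff_ratio:
  assumes r: "r \<ge> 1"
  shows "(\<lambda>n. laurent_evalc (DT_coeff n r) (cis (\<theta> * real n powr (-2/3))) / of_real (laurent_poly_eval (DT_coeff n r) 1))
    \<longlonglongrightarrow> exp (\<i> * of_real (\<theta> * (2 * real r * zeta 3) powr (-2/3) * real r * pi\<^sup>2 / 2)
       - of_real (zeta 3 * real r ^ 3 * (\<theta> * (2 * real r * zeta 3) powr (-2/3))\<^sup>2))"
    (is "_ \<longlonglongrightarrow> ?E")
proof -
  define c where "c = 2 * real r * zeta 3"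
  \<comment> \<open>The solution of n t^3 = c; the value 1 at \<open>n = 0\<close> keeps
    \<open>t\<close> positive everywhere.\<close>
  define t where "t n = (if n = 0 then 1 else (c / real n) powr (1/3))" for n :: nat
  \<comment> \<open>Chosen so that the angle \<theta> n^(-2/3) is exactly
    \<open>b * (t n)\<^sup>2\<close> for positive \<open>n\<close>.\<close>
  define b where "b = \<theta> * c powr (-2/3)"
  have c: "c > 0" using r zeta_3_pos by (simp add: c_def)
  have t: "t n > 0" for n using c by (simp add: t_def)
  have t3: "real n * t n ^ 3 = 2 * real r * zeta 3" if "n > 0" for n
  proof -
    have "t n ^ 3 = c / real n"
      using that c by (simp add: t_def powr_powr flip: powr_numeral)
    then show ?thesis using that by (simp add: c_def)
  qed
  have lim: "filterlim t (at_right 0) sequentially"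
  proof -
    have "filterlim (\<lambda>n. (c / real n) powr (1/3)) (at_right 0) sequentially"
      using c by real_asymp
    moreover have "eventually (\<lambda>n. (c / real n) powr (1/3) = t n) sequentially"
      using eventually_gt_at_top[of 0] by eventually_elim (simp add: t_def)
    ultimately show ?thesis
      by (simp cong: filterlim_cong)
  qed
  have alpha: "\<theta> * real n powr (-2/3) = b * (t n)\<^sup>2" if "n > 0" for n
  proof -
    have "(t n)\<^sup>2 = (c / real n) powr (2/3)"
      using that c by (simp add: t_def powr_powr flip: powr_numeral)
    also have "\<dots> = c powr (2/3) * real n powr (-2/3)"
      using that c by (simp add: powr_divide powr_minus_divide)
    finally show ?thesis
      using c by (simp add: b_def powr_add[symmetric])
  qed
  have "\<forall>n. \<exists>N. n < N \<and> 1 / t n \<le> real N \<and>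
    \<bar>(\<Sum>m=1..N. real m ^ 1 * bose (t n) m) - (\<Sum>m. real m ^ 1 * bose (t n) m)\<bar> \<le> 1 \<and>
    \<bar>(\<Sum>m=1..N. real m ^ 2 * bose (t n) m) - (\<Sum>m. real m ^ 2 * bose (t n) m)\<bar> \<le> 1 \<and>
    \<bar>(\<Sum>m=1..N. real m ^ 3 * (bose (t n) m * (1 + bose (t n) m))) -
      (\<Sum>m. real m ^ 3 * (bose (t n) m * (1 + bose (t n) m)))\<bar> \<le> 1"
    by (intro allI truncation_exists t)
  from choice[OF this] obtain N where "\<forall>n. n < N n \<and> 1 / t n \<le> real (N n) \<and>
    \<bar>(\<Sum>m=1..N n. real m ^ 1 * bose (t n) m) - (\<Sum>m. real m ^ 1 * bose (t n) m)\<bar> \<le> 1 \<and>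
    \<bar>(\<Sum>m=1..N n. real m ^ 2 * bose (t n) m) - (\<Sum>m. real m ^ 2 * bose (t n) m)\<bar> \<le> 1 \<and>
    \<bar>(\<Sum>m=1..N n. real m ^ 3 * (bose (t n) m * (1 + bose (t n) m))) -
      (\<Sum>m. real m ^ 3 * (bose (t n) m * (1 + bose (t n) m)))\<bar> \<le> 1" ..
  then have N: "\<And>n. n < N n" "\<And>n. 1 / t n \<le> real (N n)"
    "\<And>n. \<bar>(\<Sum>m=1..N n. real m ^ 1 * bose (t n) m) - (\<Sum>m. real m ^ 1 * bose (t n) m)\<bar> \<le> 1"
    "\<And>n. \<bar>(\<Sum>m=1..N n. real m ^ 2 * bose (t n) m) - (\<Sum>m. real m ^ 2 * bose (t n) m)\<bar> \<le> 1"
    "\<And>n. \<bar>(\<Sum>m=1..N n. real m ^ 3 * (bose (t n) m * (1 + bose (t n) m))) -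
          (\<Sum>m. real m ^ 3 * (bose (t n) m * (1 + bose (t n) m)))\<bar> \<le> 1"
    by blast+
  define J where "J b n = (LINT x:{-pi..pi}|lborel. boltzmann r (N n) (t n) x (b * (t n)\<^sup>2) * cis (- (real n * x))) / of_real ((t n)\<^sup>2)"
    for b n
  have J: "J b \<longlonglongrightarrow> exp (\<i> * of_real (b * real r * pi\<^sup>2 / 2) - of_real (zeta 3 * real r ^ 3 * b\<^sup>2)) *
       of_real (sqrt (pi / (3 * real r * zeta 3)))" for b
    unfolding J_def by (rule circle_integral_tendsto[OF r t lim t3 N(2-5)])
  \<comment> \<open>Both integrals use the same \<open>t\<close> and \<open>N\<close>. The limit of
    \<open>J 0\<close> is the positive Gaussian constant, so division is legitimate and removes that
    constant.\<close>
  have "(\<lambda>n. J b n / J 0 n) \<longlonglongrightarrow> ?E * of_real (sqrt (pi / (3 * real r * zeta 3))) / of_real (sqrt (pi / (3 * real r * zeta 3)))"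
    using r zeta_3_pos J[of 0] J[of b] unfolding b_def c_def by (intro tendsto_divide) auto
  also have "?E * of_real (sqrt (pi / (3 * real r * zeta 3))) / of_real (sqrt (pi / (3 * real r * zeta 3))) = ?E"
    using r zeta_3_pos by simp
  finally show ?thesis
  proof (rule Lim_transform_eventually)
    show "eventually (\<lambda>n. J b n / J 0 n =
        laurent_evalc (DT_coeff n r) (cis (\<theta> * real n powr (-2/3))) / of_real (laurent_poly_eval (DT_coeff n r) 1)) sequentially"
      using eventually_gt_at_top[of 0]
    proof eventually_elim
      case (elim n)
      show ?case
        unfolding alpha[OF elim] laurent_evalc_DT_coeff_ratio[OF N(1)[of n] t[of n]] J_def
        using t[of n] by simp
    qed
  qed
qed

section \<open>Characteristic functions of the normal law and of the discrete laws\<close>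

lemma char_normal:
  assumes "\<sigma> > 0"
  shows "char (density lborel (normal_density \<mu> \<sigma>)) \<theta> = exp (\<i> * of_real (\<mu> * \<theta>) - of_real (\<sigma>\<^sup>2 * \<theta>\<^sup>2 / 2))"
proof -
  interpret real_distribution std_normal_distribution
    by (rule real_dist_normal_dist)
  have "distributed std_normal_distribution lborel (\<lambda>x. x) std_normal_density"
    by (auto simp: distributed_def distr_id2)
  then have "distributed std_normal_distribution lborel (\<lambda>x. \<mu> + \<sigma> * x) (normal_density \<mu> \<sigma>)"
    using normal_standard_normal_convert[OF assms, of "\<lambda>x. \<mu> + \<sigma> * x" \<mu>] assms by simp
  then have "density lborel (normal_density \<mu> \<sigma>) = distr std_normal_distribution lborel (\<lambda>x. \<mu> + \<sigma> * x)"
    by (simp add: distributed_def)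
  then have "char (density lborel (normal_density \<mu> \<sigma>)) \<theta> = (CLINT x|std_normal_distribution. iexp (\<theta> * (\<mu> + \<sigma> * x)))"
    by (simp add: char_def integral_distr)
  also have "\<dots> = (CLINT x|std_normal_distribution. iexp (\<theta> * \<mu>) * iexp ((\<theta> * \<sigma>) * x))"
    by (intro Bochner_Integration.integral_cong refl) (simp add: algebra_simps flip: exp_add)
  also have "\<dots> = iexp (\<theta> * \<mu>) * char std_normal_distribution (\<theta> * \<sigma>)"
    by (simp add: char_def)
  also have "\<dots> = exp (\<i> * of_real (\<mu> * \<theta>) - of_real (\<sigma>\<^sup>2 * \<theta>\<^sup>2 / 2))"
    unfolding char_std_normal_distribution exp_of_real[symmetric] exp_add[symmetric]
    by (rule arg_cong[of _ _ exp]) (simp add: power_mult_distrib mult_ac)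
  finally show ?thesis .
qed

text \<open>Only point probabilities are given. Over the finite support of the coefficient they add
  up to 1, so almost surely \<open>S\<close> stays in that support and the expectation is a finite
  sum.\<close>

lemma (in prob_space) char_distr_DT_coeff:
  assumes r: "r \<ge> 1"
    and S: "S \<in> measurable M (count_space UNIV)"
    and p: "\<And>s. measure M {\<omega> \<in> space M. S \<omega> = s} = fls_nth (DT_coeff n r) s / laurent_poly_eval (DT_coeff n r) 1"
  shows "char (distr M borel (\<lambda>\<omega>. a * real_of_int (S \<omega>))) \<theta> =
    laurent_evalc (DT_coeff n r) (cis (\<theta> * a)) / of_real (laurent_poly_eval (DT_coeff n r) 1)"
proof -
  let ?f = "DT_coeff n r"
  define A where "A = {s. fls_nth ?f s \<noteq> 0}"
  define Z where "Z = laurent_poly_eval ?f 1"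
  note S[measurable]
  have A: "finite A"
    using nonneg_laurent_poly_DT_coeff[of n r] by (simp add: A_def nonneg_laurent_poly_def)
  have Z: "Z > 0"
    unfolding Z_def by (intro laurent_poly_eval_1_pos nonneg_laurent_poly_DT_coeff DT_coeff_nonzero r)
  define B where "B s = {\<omega> \<in> space M. S \<omega> = s}" for s
  have B[measurable]: "B s \<in> sets M" for s unfolding B_def by measurable
  have "prob (\<Union>s\<in>A. B s) = (\<Sum>s\<in>A. prob (B s))"
    by (rule finite_measure_finite_Union) (use A in \<open>auto simp: disjoint_family_on_def B_def\<close>)
  also have "\<dots> = 1"
    using Z unfolding B_def p by (simp add: Z_def[symmetric] A_def laurent_poly_eval_def flip: sum_divide_distrib) (simp add: Z_def laurent_poly_eval_def)
  finally have "AE \<omega> in M. \<omega> \<in> (\<Union>s\<in>A. B s)"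
    using A by (subst (asm) prob_eq_1) auto
  then have "AE \<omega> in M. iexp (\<theta> * (a * real_of_int (S \<omega>))) = (\<Sum>s\<in>A. iexp (\<theta> * (a * real_of_int s)) * of_real (indicator (B s) \<omega>))"
  proof eventually_elim
    case (elim \<omega>)
    then have S: "S \<omega> \<in> A" and \<omega>: "\<omega> \<in> space M" by (auto simp: B_def)
    have "(\<Sum>s\<in>A. iexp (\<theta> * (a * real_of_int s)) * of_real (indicator (B s) \<omega>)) =
       (\<Sum>s\<in>A. if s = S \<omega> then iexp (\<theta> * (a * real_of_int s)) else 0)"
      using \<omega> by (intro sum.cong) (auto simp: B_def)
    then show ?case using S A by simp
  qed
  then have "(CLINT \<omega>|M. iexp (\<theta> * (a * real_of_int (S \<omega>)))) =
      (CLINT \<omega>|M. (\<Sum>s\<in>A. iexp (\<theta> * (a * real_of_int s)) * of_real (indicator (B s) \<omega>)))"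
    by (intro integral_cong_AE) measurable
  also have "\<dots> = (\<Sum>s\<in>A. iexp (\<theta> * (a * real_of_int s)) * of_real (prob (B s)))"
  proof (subst Bochner_Integration.integral_sum)
    show "complex_integrable M (\<lambda>\<omega>. iexp (\<theta> * (a * real_of_int s)) * of_real (indicator (B s) \<omega>))" for s
      by (intro integrable_mult_right integrable_of_real) (simp add: integrable_indicator_iff emeasure_finite less_top[symmetric])
  qed (simp add: integral_complex_of_real)
  also have "\<dots> = laurent_evalc ?f (cis (\<theta> * a)) / of_real Z"
  proof -
    have "cis (\<theta> * a) powi s = iexp (\<theta> * (a * real_of_int s))" for s
      by (simp only: cis_power_int) (simp add: cis_conv_exp mult_ac)
    then show ?thesis
      unfolding laurent_evalc_def A_def[symmetric] sum_divide_distrib B_def p Z_def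
      by (intro sum.cong refl) (simp add: mult_ac)
  qed
  finally show ?thesis
    by (simp add: char_def integral_distr Z_def)
qed

theorem theorem2:
  fixes r :: nat
    and \<Omega> :: "nat \<Rightarrow> 'a measure"
    and S :: "nat \<Rightarrow> 'a \<Rightarrow> int"
  assumes "r \<ge> 1"
    and "\<And>n. prob_space (\<Omega> n)"
    and "\<And>n. S n \<in> measurable (\<Omega> n) (count_space UNIV)"
    and "\<And>n s. measure (\<Omega> n) {\<omega> \<in> space (\<Omega> n). S n \<omega> = s} =
           fls_nth (DT_coeff n r) s / laurent_poly_eval (DT_coeff n r) 1"
  defines "\<mu> \<equiv> real r powr (1/3) * pi\<^sup>2 / (2 powr (5/3) * zeta 3 powr (2/3))"
    and "\<sigma>2 \<equiv> real r powr (5/3) / (2 * zeta 3) powr (1/3)"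
  shows "weak_conv_m
           (\<lambda>n. distr (\<Omega> n) borel (\<lambda>\<omega>. real n powr (-2/3) * real_of_int (S n \<omega>)))
           (density lborel (normal_density \<mu> (sqrt \<sigma>2)))"
proof (rule levy_continuity)
  have z: "zeta 3 > 0" by (rule zeta_3_pos)
  have r: "real r > 0" using assms(1) by simp
  have \<sigma>2: "\<sigma>2 > 0" using r z by (simp add: \<sigma>2_def)
  have \<mu>: "(2 * real r * zeta 3) powr (-2/3) * real r * pi\<^sup>2 / 2 = \<mu>"
  proof -
    have "real r powr (1/3) = real r powr (-2/3) * real r powr 1"
      by (simp only: powr_add[symmetric]) simp
    moreover have "(2::real) powr (5/3) = 2 powr (2/3) * 2 powr 1"
      by (simp only: powr_add[symmetric]) simp
    ultimately show ?thesis
      using r z by (simp add: \<mu>_def powr_mult powr_minus_divide field_simps)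
  qed
  \<comment> \<open>The factor 2 undoes the 1/2 in the Gaussian exponent \<sigma>^2 \<theta>^2 / 2.
    Grouping y = 2 \<zeta>(3) gives y * y^(-4/3) = y^(-1/3), and r contributes 3 - 4/3 =
    5/3.\<close>
  have \<sigma>: "2 * (zeta 3 * real r ^ 3 * ((2 * real r * zeta 3) powr (-2/3))\<^sup>2) = \<sigma>2"
  proof -
    define y where "y = 2 * zeta 3"
    have y: "y > 0" using z by (simp add: y_def)
    have "((2 * real r * zeta 3) powr (-2/3))\<^sup>2 = (real r * y) powr (-4/3)"
      using r z by (simp add: y_def powr_powr mult_ac flip: powr_numeral)
    also have "\<dots> = real r powr (-4/3) * y powr (-4/3)"
      using r y by (simp add: powr_mult)
    finally have "2 * (zeta 3 * real r ^ 3 * ((2 * real r * zeta 3) powr (-2/3))\<^sup>2) =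
        (real r powr 3 * real r powr (-4/3)) * (y powr 1 * y powr (-4/3))"
      using r y by (simp add: y_def)
    also have "\<dots> = real r powr (5/3) * y powr (-1/3)"
      by (simp only: powr_add[symmetric]) simp
    finally show ?thesis
      using y by (simp add: \<sigma>2_def y_def powr_minus_divide)
  qed
  show "real_distribution (distr (\<Omega> n) borel (\<lambda>\<omega>. real n powr (-2/3) * real_of_int (S n \<omega>)))" for n
  proof -
    interpret prob_space "\<Omega> n" by fact
    note assms(3)[measurable]
    show ?thesis by (rule real_distribution_distr) measurable
  qed
  show "real_distribution (density lborel (normal_density \<mu> (sqrt \<sigma>2)))"
    using \<sigma>2 prob_space_normal_density by (simp add: real_distribution_def real_distribution_axioms_def)
  show "(\<lambda>n. char (distr (\<Omega> n) borel (\<lambda>\<omega>. real n powr (-2/3) * real_of_int (S n \<omega>))) \<theta>)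
      \<longlonglongrightarrow> char (density lborel (normal_density \<mu> (sqrt \<sigma>2))) \<theta>" for \<theta>
  proof -
    have "exp (\<i> * of_real (\<theta> * (2 * real r * zeta 3) powr (-2/3) * real r * pi\<^sup>2 / 2)
         - of_real (zeta 3 * real r ^ 3 * (\<theta> * (2 * real r * zeta 3) powr (-2/3))\<^sup>2)) =
        char (density lborel (normal_density \<mu> (sqrt \<sigma>2))) \<theta>"
      using \<sigma>2 by (subst char_normal) (simp_all add: power_mult_distrib mult_ac flip: \<mu> \<sigma>)
    then show ?thesis
      using tendsto_laurent_evalc_DT_coeff_ratio[OF assms(1), of \<theta>]
      by (simp only: prob_space.char_distr_DT_coeff[OF assms(2) assms(1) assms(3) assms(4)])
  qed
qed

end
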